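(* There exists $S\subseteq\mathbb F_2^{\omega}$ such that every translate of $S$ is a set of topological recurrence, while $S$ is not a set of measurable recurrence. Moreover, for every prime $p$ there is a set $S\subseteq\mathbb F_p^{\omega}$ such that $S$ is dense in the Bohr topology of $\mathbb F_p^{\omega}$ while $S$ is not a set of measurable recurrence.
   Context: $\mathbb F_p^{\omega}=\bigoplus_{n=1}^{\infty}\mathbb F_p$ is the countable direct sum of copies of the field with $p$ elements, viewed as a countable abelian group. A translate of $S\subseteq G$ is a set $t+S=\{t+s:s\in S\}$, $t\in G$. Let $G$ be a countable abelian group. A set $S\subseteq G$ is a set of topological recurrence if for every minimal action $(T_g)_{g\in G}$ of $G$ by homeomorphisms of a compact metric space $X$ and every nonempty open $U\subseteq X$, there is $g\in S$ with $g\neq0$ and $U\cap T_gU\neq\varnothing$. A set $S\subseteq G$ is a set of measurable recurrence if for every action $(T_g)_{g\in G}$ of $G$ by measure preserving transformations of a probability space $(X,\mathcal B,\mu)$ and every $D\in\mathcal B$ with $\mu(D)>0$, there is $g\in S$ with $g\ne0$ and $\mu(D\cap T_gD)>0$. A Bohr set in $G$ is a set of the form $\{g\in G:|\chi_j(g)-1|<\varepsilon,\ 1\le j\le k\}$, where $\varepsilon>0$ and $\chi_1,\dots,\chi_k:G\to\mathcal S^1=\{z\in\mathbb C:|z|=1\}$ are homomorphisms. The Bohr topology on $G$ is the topology whose neighborhoods are the sets containing a translate of a Bohr set; so $S\subseteq G$ is dense in the Bohr topology iff $S$ meets every translate of every Bohr set. *)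

theory Defs
  imports "HOL-Probability.Probability" "HOL-Algebra.Group_Action" "HOL-Algebra.Product_Groups"
begin

text \<open>Groups are those of HOL-Algebra, hence written multiplicatively: the neutral element is
  \<open>\<one>\<^bsub>G\<^esub>\<close> and the translate \<open>t + S\<close> is the left coset \<open>t <#\<^bsub>G\<^esub> S\<close>.\<close>

definition Fp_omega :: "nat \<Rightarrow> (nat \<Rightarrow> int) monoid"
  where "Fp_omega p = sum_group (UNIV :: nat set) (\<lambda>_. integer_mod_group p)"

subsection \<open>Topological recurrence\<close>

definition minimal_action ::
    "('g, 'm) monoid_scheme \<Rightarrow> 'x topology \<Rightarrow> ('g \<Rightarrow> 'x \<Rightarrow> 'x) \<Rightarrow> bool"
  where "minimal_action G X T \<longleftrightarrow>
    group_action G (topspace X) T \<and>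
    (\<forall>g\<in>carrier G. homeomorphic_map X X (T g)) \<and>
    (\<forall>x\<in>topspace X. X closure_of (orbit G T x) = topspace X)"

text \<open>HOL cannot quantify over types inside a definition, so the points of \<open>X\<close> are taken in
  \<^typ>\<open>real\<close>; the topology of \<open>X\<close> is arbitrary. This is no restriction since a compact
  metrizable space has at most continuum many points: see \<open>topological_recurrence_any_type\<close>.\<close>

definition topological_recurrence :: "('g, 'm) monoid_scheme \<Rightarrow> 'g set \<Rightarrow> bool"
  where "topological_recurrence G S \<longleftrightarrow>
    (\<forall>(X :: real topology) T U.
       compact_space X \<and> metrizable_space X \<and> minimal_action G X T \<and> openin X U \<and> U \<noteq> {}
       \<longrightarrow> (\<exists>g\<in>S. g \<noteq> \<one>\<^bsub>G\<^esub> \<and> U \<inter> T g ` U \<noteq> {}))"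

lemma compact_metrizable_inj_real:
  fixes X :: "'x topology"
  assumes "compact_space X" "metrizable_space X"
  obtains f :: "'x \<Rightarrow> real" where "inj_on f (topspace X)"
proof -
  obtain M d where "Metric_space M d" and X: "X = Metric_space.mtopology M d"
    using assms(2) unfolding metrizable_space_def by blast
  interpret Metric_space M d by fact
  have "mtotally_bounded M"
    using assms(1) compactin_imp_mtotally_bounded X
    by (metis compact_space_def topspace_mtopology)
  then have "\<exists>K. finite K \<and> K \<subseteq> M \<and> M \<subseteq> (\<Union>a\<in>K. mball a (1 / real (Suc n)))" for n
    unfolding mtotally_bounded_def by simp
  then obtain K where K: "\<And>n. finite (K n)" "\<And>n. K n \<subseteq> M"
      "\<And>n. M \<subseteq> (\<Union>a\<in>K n. mball a (1 / real (Suc n)))"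
    by metis
  define P where "P = (SIGMA n:(UNIV::nat set). K n)"
  have "countable P"
    unfolding P_def by (intro countable_SIGMA) (auto simp: K countable_finite)
  define F where "F x = {(n, a) \<in> P. d a x < 1 / real (Suc n)}" for x
  have F: "inj_on F M"
  proof (rule inj_onI, rule ccontr)
    fix x y assume xy: "x \<in> M" "y \<in> M" "F x = F y" "x \<noteq> y"
    then have "0 < d x y / 2" by simp
    then obtain n where n: "1 / real (Suc n) < d x y / 2"
      using nat_approx_posE by blast
    obtain a where a: "a \<in> K n" "d a x < 1 / real (Suc n)"
      using K(3)[of n] xy(1) by (auto simp: mball_def)
    then have "(n, a) \<in> F x" by (simp add: F_def P_def)
    then have "(n, a) \<in> F y" using xy(3) by simp
    then have "d a y < 1 / real (Suc n)" by (simp add: F_def)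
    moreover have "d x y \<le> d a x + d a y"
      using triangle'[of x a y] K(2) a(1) xy by (metis commute subsetD triangle)
    ultimately show False using a(2) n by linarith
  qed
  obtain h :: "nat set \<Rightarrow> real" where h: "inj h"
    using nat_sets_eqpoll_reals unfolding eqpoll_def bij_betw_def by blast
  have "inj_on (\<lambda>x. to_nat_on P ` F x) M"
  proof (rule inj_onI)
    fix x y assume "x \<in> M" "y \<in> M" "to_nat_on P ` F x = to_nat_on P ` F y"
    moreover have "F x \<subseteq> P" "F y \<subseteq> P" by (auto simp: F_def)
    ultimately show "x = y"
      using inj_on_image_eq_iff[OF inj_on_to_nat_on[OF \<open>countable P\<close>]] F
      by (metis inj_on_eq_iff)
  qed
  then have "inj_on (\<lambda>x. h (to_nat_on P ` F x)) (topspace X)"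
    using h unfolding X by (simp add: inj_on_def)
  then show thesis by (rule that)
qed

lemma topological_recurrence_any_type:
  fixes X :: "'x topology"
  assumes rec: "topological_recurrence G S" and S: "S \<subseteq> carrier G"
    and X: "compact_space X" "metrizable_space X"
    and T: "minimal_action G X T" and U: "openin X U" "U \<noteq> {}"
  shows "\<exists>g\<in>S. g \<noteq> \<one>\<^bsub>G\<^esub> \<and> U \<inter> T g ` U \<noteq> {}"
proof -
  obtain f :: "'x \<Rightarrow> real" where f: "inj_on f (topspace X)"
    using compact_metrizable_inj_real[OF X] .
  define A where "A = f ` topspace X"
  define e where "e = inv_into (topspace X) f"
  have fe: "f (e y) = y" "e y \<in> topspace X" if "y \<in> A" for y
    using that by (auto simp: A_def e_def f_inv_into_f inv_into_into)
  have ef: "e (f x) = x" "f x \<in> A" if "x \<in> topspace X" for x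
    using that f by (auto simp: A_def e_def)
  define Y where "Y = pullback_topology A e X"
  have topY: "topspace Y = A"
    using fe(2) by (auto simp: Y_def topspace_pullback_topology)
  have conte: "continuous_map Y X e"
    using continuous_map_pullback[OF continuous_map_id, of A e X] by (simp add: Y_def)
  have contf: "continuous_map X Y f"
    unfolding Y_def
  proof (rule continuous_map_pullback')
    show "continuous_map X X (e \<circ> f)"
      by (rule continuous_map_eq[OF continuous_map_id]) (simp add: ef)
    show "topspace X \<subseteq> f -` A" using ef by auto
  qed
  have hom: "homeomorphic_maps X Y f e"
    using conte contf ef fe by (simp add: homeomorphic_maps_def topY)
  then have mapf: "homeomorphic_map X Y f" and mape: "homeomorphic_map Y X e"
    using homeomorphic_maps_map by (blast, metis homeomorphic_maps_sym homeomorphic_maps_map)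
  have "X homeomorphic_space Y"
    using hom by (auto simp: homeomorphic_space_def)
  then have Y: "compact_space Y" "metrizable_space Y"
    using X homeomorphic_compact_space homeomorphic_metrizable_space by blast+
  interpret T: group_action G "topspace X" T
    using T by (simp add: minimal_action_def)
  interpret G: group G
    using T.group_hom by (simp add: group_hom_def)
  define T' where "T' g = (\<lambda>y\<in>A. f (T g (e y)))" for g
  have TX: "T g x \<in> topspace X" if "g \<in> carrier G" "x \<in> topspace X" for g x
    using that T.element_image by blast
  have T'A: "T' g y \<in> A" if "g \<in> carrier G" "y \<in> A" for g y
    using that fe ef TX by (simp add: T'_def)
  have comp: "T' (g \<otimes>\<^bsub>G\<^esub> h) y = T' g (T' h y)" if "g \<in> carrier G" "h \<in> carrier G" "y \<in> A" for g h y
    using that fe ef TX T'A[of h y] by (simp add: T'_def T.composition_rule)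
  have one: "T' \<one>\<^bsub>G\<^esub> y = y" if "y \<in> A" for y
    using that fe T.id_eq_one by (simp add: T'_def) (metis restrict_apply')
  have bij: "T' g \<in> Bij A" if g: "g \<in> carrier G" for g
  proof -
    have "bij_betw (T' g) A A"
      by (rule bij_betw_byWitness[where f' = "T' (inv\<^bsub>G\<^esub> g)"])
         (use g comp[of "inv\<^bsub>G\<^esub> g" g] comp[of g "inv\<^bsub>G\<^esub> g"] one T'A in auto)
    then show ?thesis by (simp add: Bij_def T'_def)
  qed
  have act: "group_action G (topspace Y) T'"
    unfolding topY
  proof (intro group_action.intro group_hom.intro group_hom_axioms.intro homI)
    fix g h assume gh: "g \<in> carrier G" "h \<in> carrier G"
    have "T' (g \<otimes>\<^bsub>G\<^esub> h) = compose A (T' g) (T' h)"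
    proof
      fix y show "T' (g \<otimes>\<^bsub>G\<^esub> h) y = compose A (T' g) (T' h) y"
        using comp[OF gh] by (cases "y \<in> A") (auto simp: compose_def T'_def)
    qed
    then show "T' (g \<otimes>\<^bsub>G\<^esub> h) = T' g \<otimes>\<^bsub>BijGroup A\<^esub> T' h"
      using bij gh by (simp add: BijGroup_def)
  qed (use bij in \<open>auto simp: BijGroup_def group_BijGroup[unfolded BijGroup_def] G.is_group\<close>)
  have homT: "homeomorphic_map Y Y (T' g)" if "g \<in> carrier G" for g
  proof -
    have "homeomorphic_map Y Y (f \<circ> (T g \<circ> e))"
      using T that mapf mape unfolding minimal_action_def
      by (blast intro: homeomorphic_map_compose)
    then show ?thesis
      by (rule homeomorphic_map_eq) (simp add: T'_def topY)
  qed
  have orb: "Y closure_of (orbit G T' y) = topspace Y" if y: "y \<in> topspace Y" for y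
  proof -
    have eq: "orbit G T' y = f ` orbit G T (e y)"
      using y by (auto simp: orbit_def T'_def topY)
    have "orbit G T (e y) \<subseteq> topspace X"
      using TX fe y topY by (auto simp: orbit_def)
    then have "Y closure_of (orbit G T' y) = f ` (X closure_of (orbit G T (e y)))"
      unfolding eq using homeomorphic_map_closure_of[OF mapf] by metis
    also have "\<dots> = topspace Y"
      using T fe y unfolding minimal_action_def by (simp add: topY A_def)
    finally show ?thesis .
  qed
  have "minimal_action G Y T'"
    using act homT orb by (simp add: minimal_action_def)
  moreover have "openin Y (f ` U)" "f ` U \<noteq> {}"
    using mapf U homeomorphic_map_openness_eq[OF mapf] by blast+
  ultimately have "\<exists>g\<in>S. g \<noteq> \<one>\<^bsub>G\<^esub> \<and> f ` U \<inter> T' g ` (f ` U) \<noteq> {}"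
    using rec[unfolded topological_recurrence_def, rule_format, of Y T' "f ` U"] Y by simp
  then obtain g where g: "g \<in> S" "g \<noteq> \<one>\<^bsub>G\<^esub>" "f ` U \<inter> T' g ` (f ` U) \<noteq> {}"
    by (elim bexE conjE)
  have UX: "U \<subseteq> topspace X" using U(1) openin_subset by blast
  obtain u v where uv: "u \<in> U" "v \<in> U" "f u = T' g (f v)"
    using g(3) by blast
  then have "f u = f (T g v)"
    using UX ef by (auto simp: T'_def)
  then have "u = T g v"
    using f UX uv TX g(1) S by (meson inj_onD subsetD)
  then show ?thesis using g uv by blast
qed

subsection \<open>Measurable recurrence\<close>

definition measure_preserving_action ::
    "('g, 'm) monoid_scheme \<Rightarrow> 'x measure \<Rightarrow> ('g \<Rightarrow> 'x \<Rightarrow> 'x) \<Rightarrow> bool"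
  where "measure_preserving_action G M T \<longleftrightarrow>
    group_action G (space M) T \<and>
    (\<forall>g\<in>carrier G. T g \<in> measurable M M \<and> distr M M (T g) = M)"

text \<open>Here too the points of the probability space are taken in \<^typ>\<open>real\<close>, with an
  arbitrary underlying set and sigma-algebra. For countable \<open>G\<close> this is no restriction: the
  measures of the sets \<open>D \<inter> T g D\<close> do not change when a system is replaced by its factor
  \<open>x \<mapsto> (g \<mapsto> indicator (T g D) x)\<close>, whose points lie in \<open>{0,1}\<close> to the power \<open>G\<close> and so can be
  encoded as real numbers.\<close>

definition measurable_recurrence :: "('g, 'm) monoid_scheme \<Rightarrow> 'g set \<Rightarrow> bool"
  where "measurable_recurrence G S \<longleftrightarrow>
    (\<forall>(M :: real measure) T D.
       prob_space M \<and> measure_preserving_action G M T \<and> D \<in> sets M \<and> measure M D > 0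
       \<longrightarrow> (\<exists>g\<in>S. g \<noteq> \<one>\<^bsub>G\<^esub> \<and> measure M (D \<inter> T g ` D) > 0))"

subsection \<open>The Bohr topology\<close>

definition circle_group :: "complex monoid"
  where "circle_group = \<lparr>carrier = {z. cmod z = 1}, monoid.mult = (*), one = 1\<rparr>"

definition bohr_set :: "('g, 'm) monoid_scheme \<Rightarrow> 'g set \<Rightarrow> bool"
  where "bohr_set G B \<longleftrightarrow>
    (\<exists>\<epsilon>>0. \<exists>k \<xi>. (\<forall>j\<in>{1..k::nat}. \<xi> j \<in> hom G circle_group) \<and>
       B = {g \<in> carrier G. \<forall>j\<in>{1..k}. cmod (\<xi> j g - 1) < \<epsilon>})"

definition bohr_topology :: "('g, 'm) monoid_scheme \<Rightarrow> 'g topology"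
  where "bohr_topology G =
    topology (\<lambda>U. U \<subseteq> carrier G \<and> (\<forall>x\<in>U. \<exists>B. bohr_set G B \<and> x <#\<^bsub>G\<^esub> B \<subseteq> U))"

definition bohr_dense :: "('g, 'm) monoid_scheme \<Rightarrow> 'g set \<Rightarrow> bool"
  where "bohr_dense G S \<longleftrightarrow> bohr_topology G closure_of S = carrier G"

lemma bohr_set_Int:
  assumes "bohr_set G B" "bohr_set G C"
  shows "\<exists>D. bohr_set G D \<and> D \<subseteq> B \<inter> C"
proof -
  obtain \<epsilon> k \<xi> where b: "\<epsilon> > 0" "\<And>j. j \<in> {1..k::nat} \<Longrightarrow> \<xi> j \<in> hom G circle_group"
      "B = {g \<in> carrier G. \<forall>j\<in>{1..k}. cmod (\<xi> j g - 1) < \<epsilon>}"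
    using assms(1) unfolding bohr_set_def by blast
  obtain \<delta> l \<psi> where c: "\<delta> > 0" "\<And>j. j \<in> {1..l::nat} \<Longrightarrow> \<psi> j \<in> hom G circle_group"
      "C = {g \<in> carrier G. \<forall>j\<in>{1..l}. cmod (\<psi> j g - 1) < \<delta>}"
    using assms(2) unfolding bohr_set_def by blast
  define \<phi> where "\<phi> j = (if j \<le> k then \<xi> j else \<psi> (j - k))" for j
  define D where "D = {g \<in> carrier G. \<forall>j\<in>{1..k+l}. cmod (\<phi> j g - 1) < min \<epsilon> \<delta>}"
  have "\<phi> j \<in> hom G circle_group" if "j \<in> {1..k+l}" for j
  proof (cases "j \<le> k")
    case True
    then show ?thesis using that b(2)[of j] by (simp add: \<phi>_def)
  next
    case False
    then have "j - k \<in> {1..l}" using that by auto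
    then show ?thesis using False c(2) by (simp add: \<phi>_def)
  qed
  then have "bohr_set G D"
    unfolding bohr_set_def D_def using b(1) c(1)
    by (intro exI[of _ "min \<epsilon> \<delta>"] conjI exI[of _ "k + l"] exI[of _ \<phi>]) auto
  moreover have "D \<subseteq> B"
  proof
    fix g assume "g \<in> D"
    then have g: "g \<in> carrier G" "\<And>j. j \<in> {1..k+l} \<Longrightarrow> cmod (\<phi> j g - 1) < min \<epsilon> \<delta>"
      by (auto simp: D_def)
    have "cmod (\<xi> j g - 1) < \<epsilon>" if "j \<in> {1..k}" for j
      using g(2)[of j] that by (auto simp: \<phi>_def)
    then show "g \<in> B" using g(1) b(3) by blast
  qed
  moreover have "D \<subseteq> C"
  proof
    fix g assume "g \<in> D"
    then have g: "g \<in> carrier G" "\<And>j. j \<in> {1..k+l} \<Longrightarrow> cmod (\<phi> j g - 1) < min \<epsilon> \<delta>"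
      by (auto simp: D_def)
    have "cmod (\<psi> j g - 1) < \<delta>" if "j \<in> {1..l}" for j
      using g(2)[of "k + j"] that by (auto simp: \<phi>_def)
    then show "g \<in> C" using g(1) c(3) by blast
  qed
  ultimately show ?thesis by blast
qed

lemma openin_bohr_topology:
  "openin (bohr_topology G) U \<longleftrightarrow>
     U \<subseteq> carrier G \<and> (\<forall>x\<in>U. \<exists>B. bohr_set G B \<and> x <#\<^bsub>G\<^esub> B \<subseteq> U)"
proof -
  let ?L = "\<lambda>U. U \<subseteq> carrier G \<and> (\<forall>x\<in>U. \<exists>B. bohr_set G B \<and> x <#\<^bsub>G\<^esub> B \<subseteq> U)"
  have "?L (U \<inter> V)" if UV: "?L U" "?L V" for U V
  proof (intro conjI ballI)
    show "U \<inter> V \<subseteq> carrier G" using UV by blast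
    fix x assume "x \<in> U \<inter> V"
    then obtain B C where BC: "bohr_set G B" "x <#\<^bsub>G\<^esub> B \<subseteq> U"
        "bohr_set G C" "x <#\<^bsub>G\<^esub> C \<subseteq> V"
      using UV by blast
    obtain D where D: "bohr_set G D" "D \<subseteq> B \<inter> C"
      using bohr_set_Int[OF BC(1,3)] by blast
    have "x <#\<^bsub>G\<^esub> D \<subseteq> U \<inter> V"
      using D(2) BC(2,4) unfolding l_coset_def by blast
    then show "\<exists>B. bohr_set G B \<and> x <#\<^bsub>G\<^esub> B \<subseteq> U \<inter> V"
      using D(1) by blast
  qed
  moreover have "?L (\<Union>\<K>)" if "\<forall>K\<in>\<K>. ?L K" for \<K>
    using that by (meson Sup_le_iff Sup_upper UnionE subset_trans)
  ultimately have "istopology ?L"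
    unfolding istopology_def by blast
  then show ?thesis
    unfolding bohr_topology_def by (simp add: topology_inverse')
qed

lemma topspace_bohr_topology:
  assumes "group G"
  shows "topspace (bohr_topology G) = carrier G"
proof -
  interpret group G by fact
  have "bohr_set G (carrier G)"
    unfolding bohr_set_def by (intro exI[of _ 1] conjI exI[of _ 0]) auto
  then have "openin (bohr_topology G) (carrier G)"
    unfolding openin_bohr_topology using l_coset_subset_G by blast
  then show ?thesis
    using openin_subset[of "bohr_topology G" "carrier G"] openin_topspace[of "bohr_topology G"]
    unfolding openin_bohr_topology[of G "topspace (bohr_topology G)"] by blast
qed

lemma one_in_bohr_set:
  assumes "group G" "bohr_set G B"
  shows "\<one>\<^bsub>G\<^esub> \<in> B"
proof -
  interpret group G by fact
  have one: "\<xi> \<one>\<^bsub>G\<^esub> = 1" if "\<xi> \<in> hom G circle_group" for \<xi>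
  proof -
    have "\<xi> \<one>\<^bsub>G\<^esub> * \<xi> \<one>\<^bsub>G\<^esub> = \<xi> \<one>\<^bsub>G\<^esub>" "cmod (\<xi> \<one>\<^bsub>G\<^esub>) = 1"
      using that hom_mult[OF that, of "\<one>\<^bsub>G\<^esub>" "\<one>\<^bsub>G\<^esub>"] hom_in_carrier[OF that, of "\<one>\<^bsub>G\<^esub>"]
      by (auto simp: circle_group_def)
    then show ?thesis by (metis mult_cancel_left2 norm_zero zero_neq_one)
  qed
  obtain \<epsilon> k \<xi> where b: "\<epsilon> > 0" "\<And>j. j \<in> {1..k::nat} \<Longrightarrow> \<xi> j \<in> hom G circle_group"
      "B = {g \<in> carrier G. \<forall>j\<in>{1..k}. cmod (\<xi> j g - 1) < \<epsilon>}"
    using assms(2) unfolding bohr_set_def by blast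
  have "cmod (\<xi> j \<one>\<^bsub>G\<^esub> - 1) < \<epsilon>" if "j \<in> {1..k}" for j
    using one[OF b(2)[OF that]] b(1) by simp
  then show ?thesis using b(3) by blast
qed

lemma openin_translate_bohr_set:
  assumes "group G" "bohr_set G B" "t \<in> carrier G"
  shows "openin (bohr_topology G) (t <#\<^bsub>G\<^esub> B)"
proof -
  interpret group G by fact
  obtain \<epsilon> k \<xi> where b: "\<epsilon> > 0" "\<And>j. j \<in> {1..k::nat} \<Longrightarrow> \<xi> j \<in> hom G circle_group"
      "B = {g \<in> carrier G. \<forall>j\<in>{1..k}. cmod (\<xi> j g - 1) < \<epsilon>}"
    using assms(2) unfolding bohr_set_def by blast
  have BG: "B \<subseteq> carrier G" using b(3) by blast
  have "\<exists>C. bohr_set G C \<and> x <#\<^bsub>G\<^esub> C \<subseteq> t <#\<^bsub>G\<^esub> B" if x: "x \<in> t <#\<^bsub>G\<^esub> B" for x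
  proof -
    obtain g where g: "g \<in> B" "x = t \<otimes>\<^bsub>G\<^esub> g" using x by (auto simp: l_coset_def)
    have gG: "g \<in> carrier G" using g BG by blast
    obtain \<delta> where \<delta>: "\<delta> > 0" "\<And>j. j \<in> {1..k} \<Longrightarrow> cmod (\<xi> j g - 1) + \<delta> \<le> \<epsilon>"
    proof -
      let ?R = "insert \<epsilon> ((\<lambda>j. \<epsilon> - cmod (\<xi> j g - 1)) ` {1..k})"
      have "Min ?R > 0" using b(1,3) g(1) by auto
      moreover have "cmod (\<xi> j g - 1) + Min ?R \<le> \<epsilon>" if "j \<in> {1..k}" for j
      proof -
        have "Min ?R \<le> \<epsilon> - cmod (\<xi> j g - 1)" using that by (intro Min_le) auto
        then show ?thesis by linarith
      qed
      ultimately show thesis by (rule that)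
    qed
    define C where "C = {h \<in> carrier G. \<forall>j\<in>{1..k}. cmod (\<xi> j h - 1) < \<delta>}"
    have "bohr_set G C"
      unfolding bohr_set_def C_def using \<delta>(1) b(2) by blast
    moreover have "g \<otimes>\<^bsub>G\<^esub> h \<in> B" if "h \<in> C" for h
    proof -
      have h: "h \<in> carrier G" using that by (simp add: C_def)
      have "cmod (\<xi> j (g \<otimes>\<^bsub>G\<^esub> h) - 1) < \<epsilon>" if j: "j \<in> {1..k}" for j
      proof -
        have "\<xi> j (g \<otimes>\<^bsub>G\<^esub> h) = \<xi> j g * \<xi> j h"
          using hom_mult[OF b(2)[OF j] gG h] by (simp add: circle_group_def)
        then have "\<xi> j (g \<otimes>\<^bsub>G\<^esub> h) - 1 = \<xi> j g * (\<xi> j h - 1) + (\<xi> j g - 1)"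
          by (simp add: algebra_simps)
        then have "cmod (\<xi> j (g \<otimes>\<^bsub>G\<^esub> h) - 1) \<le> cmod (\<xi> j g) * cmod (\<xi> j h - 1) + cmod (\<xi> j g - 1)"
          by (metis norm_mult norm_triangle_ineq)
        moreover have "cmod (\<xi> j g) = 1"
          using hom_in_carrier[OF b(2)[OF j] gG] by (simp add: circle_group_def)
        moreover have "cmod (\<xi> j h - 1) < \<delta>" using \<open>h \<in> C\<close> j by (simp add: C_def)
        ultimately show ?thesis using \<delta>(2)[OF j] by auto
      qed
      then show ?thesis using gG h by (simp add: b(3))
    qed
    then have "x <#\<^bsub>G\<^esub> C \<subseteq> t <#\<^bsub>G\<^esub> B"
      using assms(3) gG g(2) by (auto simp: l_coset_def C_def m_assoc)
    ultimately show ?thesis by blast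
  qed
  then show ?thesis
    using l_coset_subset_G[OF BG assms(3)] by (simp add: openin_bohr_topology)
qed

lemma bohr_dense_iff:
  assumes "group G" "S \<subseteq> carrier G"
  shows "bohr_dense G S \<longleftrightarrow> (\<forall>t\<in>carrier G. \<forall>B. bohr_set G B \<longrightarrow> S \<inter> (t <#\<^bsub>G\<^esub> B) \<noteq> {})"
proof -
  interpret group G by fact
  have self: "t \<in> t <#\<^bsub>G\<^esub> B" if "t \<in> carrier G" "bohr_set G B" for t B
    using that one_in_bohr_set[OF assms(1) that(2)] by (force simp: l_coset_def)
  have "bohr_dense G S \<longleftrightarrow>
      (\<forall>U. openin (bohr_topology G) U \<and> U \<noteq> {} \<longrightarrow> S \<inter> U \<noteq> {})"
    unfolding bohr_dense_def using dense_intersects_open[of "bohr_topology G" S]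
    by (simp add: topspace_bohr_topology[OF assms(1)])
  also have "\<dots> \<longleftrightarrow> (\<forall>t\<in>carrier G. \<forall>B. bohr_set G B \<longrightarrow> S \<inter> (t <#\<^bsub>G\<^esub> B) \<noteq> {})"
  proof (intro iffI ballI allI impI)
    fix t B
    assume "\<forall>U. openin (bohr_topology G) U \<and> U \<noteq> {} \<longrightarrow> S \<inter> U \<noteq> {}"
      and "t \<in> carrier G" "bohr_set G B"
    then show "S \<inter> (t <#\<^bsub>G\<^esub> B) \<noteq> {}"
      using self openin_translate_bohr_set[OF assms(1)] by blast
  next
    fix U
    assume L: "\<forall>t\<in>carrier G. \<forall>B. bohr_set G B \<longrightarrow> S \<inter> (t <#\<^bsub>G\<^esub> B) \<noteq> {}"
      and U: "openin (bohr_topology G) U \<and> U \<noteq> {}"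
    then obtain x where x: "x \<in> U" by blast
    then obtain B where "x \<in> carrier G" "bohr_set G B" "x <#\<^bsub>G\<^esub> B \<subseteq> U"
      using U unfolding openin_bohr_topology by blast
    then show "S \<inter> U \<noteq> {}" using L by blast
  qed
  finally show ?thesis .
qed

end

theory Submission
  imports Defs "HOL-Number_Theory.Cong"
begin

text \<open>
  Write \<open>G\<close> for the direct sum of copies of the integers modulo \<open>p\<close>. Enumerate \<open>G\<close> as
  \<open>t\<^sub>0, t\<^sub>1, \<dots>\<close> with every element repeated infinitely often, choose consecutive blocks
  \<open>I\<^sub>0, I\<^sub>1, \<dots>\<close> of coordinates such that \<open>I\<^sub>j\<close> lies beyond the support of \<open>t\<^sub>j\<close>, and let
  \<open>S\<close> be the union of the sets \<open>t\<^sub>j + E\<^sub>j\<close>, where \<open>E\<^sub>j\<close> consists of the vectors supported on \<open>I\<^sub>j\<close>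
  with at most \<open>j\<close> coordinates of \<open>I\<^sub>j\<close> different from 1. One and the same \<open>S\<close> serves for all the
  claims, provided that the blocks are long enough. Every translate of \<open>S\<close> contains sets
  \<open>s + E\<^sub>j\<close> with any prescribed \<open>s\<close> and with \<open>j\<close> arbitrarily large, so that the two positive
  claims only concern the sets \<open>E\<^sub>j\<close>.

  Topological recurrence (\<open>topological_recurrence_near_ones\<close>). In a minimal system finitely many,
  say \<open>r\<close>, translates of \<open>U\<close> cover the space. Following the orbit of a point along the cube of
  0-1-vectors on \<open>I\<^sub>j\<close> colours that cube with \<open>r\<close> colours, and some two points of the
  same colour differ in all but at most \<open>r\<close> coordinates (\<open>cube_near_antipodal\<close>). For \<open>p = 2\<close> their
  difference lies in \<open>E\<^sub>j\<close> as soon as \<open>r \<le> j\<close>, and it returns \<open>U\<close> to itself. The colouring statement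
  is of the strength of Kneser's conjecture and comes from Ky Fan's combinatorial form of the
  Borsuk-Ulam theorem (\<open>exists_large_label\<close>).

  Bohr density (\<open>bohr_dense_near_ones\<close>). Among the vectors on \<open>I\<^sub>j\<close> that are killed by \<open>k\<close> given
  characters, one with as many coordinates 1 as possible has at most \<open>k\<close> other coordinates, since
  otherwise the pigeonhole principle gives a vector killed by all the characters with which one of
  them can be corrected. So \<open>E\<^sub>j\<close> meets every Bohr set of rank at most \<open>j\<close>.

  No measurable recurrence (\<open>good_disjoint\<close>, \<open>good_positive\<close>). Let \<open>G\<close> act on random digit sequences
  by translation, and let \<open>c\<^sub>j(x)\<close> be the most frequent digit of \<open>x\<close> in \<open>I\<^sub>j\<close>. By the central limit
  theorem \<open>c\<^sub>j(x)\<close> wins by more than \<open>2j\<close> occurrences, except with small probability when \<open>I\<^sub>j\<close>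
  is long, and then adding an element of \<open>E\<^sub>j\<close> raises it by exactly 1. Conjugate the translations
  by the maps \<open>x \<mapsto> x + c\<^sub>j(x)(t\<^sub>j + \<delta>\<^sub>0)\<close>, where \<open>\<delta>\<^sub>0\<close> is the unit vector at the coordinate 0. In the
  new action an element \<open>t\<^sub>j + e\<close> of \<open>S\<close> acts on a typical \<open>x\<close> as \<open>x \<mapsto> x + e - \<delta>\<^sub>0\<close>
  (\<open>act_near_ones\<close>): the rise of \<open>c\<^sub>j\<close> absorbs \<open>t\<^sub>j\<close> and leaves \<open>- \<delta>\<^sub>0\<close> behind. Thus it changes the digit
  at 0, and the set of typical sequences with digit 0 there never returns to itself.
\<close>



section \<open>Ky Fan's parity count\<close>

fun alternating_list :: "bool \<Rightarrow> int list \<Rightarrow> bool" where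
  "alternating_list b [] \<longleftrightarrow> True"
| "alternating_list b (x # xs) \<longleftrightarrow>
     (0 < x) = b \<and> (\<forall>y\<in>set xs. \<bar>x\<bar> < \<bar>y\<bar>) \<and> alternating_list (\<not> b) xs"

text \<open>A multiset rather than a set of labels, because the count below has to see that a label occurs
  twice.\<close>

definition alternating :: "bool \<Rightarrow> int multiset \<Rightarrow> bool" where
  "alternating b M \<longleftrightarrow> (\<exists>xs. mset xs = M \<and> alternating_list b xs)"

lemma alternating_list_sorted:
  assumes "alternating_list b xs"
  shows "sorted (map abs xs)" and "distinct (map abs xs)"
  using assms by (induction b xs rule: alternating_list.induct) (force simp: less_imp_le)+

lemma alternating_list_uminus:
  assumes "alternating_list b xs" "0 \<notin> set xs"
  shows "alternating_list (\<not> b) (map uminus xs)"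
  using assms by (induction b xs rule: alternating_list.induct) auto

lemma alternating_uminus:
  assumes "0 \<notin># M"
  shows "alternating b (image_mset uminus M) \<longleftrightarrow> alternating (\<not> b) M"
proof
  assume "alternating b (image_mset uminus M)"
  then obtain xs where xs: "mset xs = image_mset uminus M" "alternating_list b xs"
    by (auto simp: alternating_def)
  have "mset (map uminus xs) = image_mset uminus (image_mset uminus M)"
    using xs(1) by simp
  also have "\<dots> = M" by (simp add: image_mset.compositionality comp_def)
  finally have "mset (map uminus xs) = M" .
  moreover have "0 \<notin> set xs"
    using assms xs(1) by (metis (no_types, lifting) imageE neg_equal_0_iff_equal set_image_mset set_mset_mset)
  ultimately show "alternating (\<not> b) M"
    using alternating_list_uminus[OF xs(2)] unfolding alternating_def by blast
next
  assume "alternating (\<not> b) M"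
  then obtain xs where xs: "mset xs = M" "alternating_list (\<not> b) xs"
    by (auto simp: alternating_def)
  have "0 \<notin> set xs" using assms xs(1) by auto
  then have "alternating_list b (map uminus xs)"
    using alternating_list_uminus[OF xs(2)] by simp
  then show "alternating b (image_mset uminus M)"
    using xs(1) unfolding alternating_def by (metis mset_map)
qed

lemma alternating_mset_iff:
  assumes sorted: "sorted (map abs xs)" and nocomp: "\<forall>x\<in>set xs. x \<noteq> 0 \<and> - x \<notin> set xs"
  shows "alternating b (mset xs) \<longleftrightarrow> alternating_list b xs"
proof
  assume "alternating b (mset xs)"
  then obtain ys where ys: "mset ys = mset xs" "alternating_list b ys"
    by (auto simp: alternating_def)
  have set: "set ys = set xs" using ys(1) mset_eq_setD by blast
  have inj: "inj_on abs (set xs)"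
    using nocomp by (auto simp: inj_on_def abs_eq_iff)
  have "sort_key abs xs = ys"
    by (rule sort_key_inj_key_eq) (use ys inj alternating_list_sorted in auto)
  moreover have "sort_key abs xs = xs"
    by (rule sort_key_inj_key_eq) (use inj sorted in auto)
  ultimately show "alternating_list b xs" using ys by simp
qed (auto simp: alternating_def)

fun deletions :: "'a list \<Rightarrow> 'a list list" where
  "deletions [] = []"
| "deletions (x # xs) = xs # map ((#) x) (deletions xs)"

lemma set_deletions:
  "ys \<in> set (deletions xs) \<Longrightarrow> set ys \<subseteq> set xs"
  by (induction xs arbitrary: ys) fastforce+

lemma sorted_deletions:
  "ys \<in> set (deletions xs) \<Longrightarrow> sorted (map f xs) \<Longrightarrow> sorted (map f ys)"
  by (induction xs arbitrary: ys) (use set_deletions in fastforce)+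

lemma mset_deletions:
  "map mset (deletions xs) = map (\<lambda>x. mset xs - {#x#}) xs"
proof (induction xs)
  case (Cons x xs)
  have "map (mset \<circ> (#) x) (deletions xs) = map (add_mset x) (map mset (deletions xs))"
    by simp
  also have "\<dots> = map (\<lambda>y. add_mset x (mset xs) - {#y#}) xs"
    unfolding Cons.IH by (auto simp: add_mset_diff_bothsides)
  finally show ?case by simp
qed simp

text \<open>If the list alternates, there is exactly one deletion that leaves an alternating list starting with
  the sign \<open>b\<close>: the label of largest absolute value if the list starts with \<open>b\<close>, the one of smallest
  absolute value otherwise. If it does not alternate, a deletion can repair it only by
  removing one of two neighbours of the same sign, and removing either of them has the same effect.
  Labels of equal absolute value are such neighbours, because complementary labels are excluded.\<close>

lemma even_deletions_list:
  assumes "sorted (map abs xs)" "\<forall>x\<in>set xs. x \<noteq> 0 \<and> - x \<notin> set xs"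
  shows "even ((\<Sum>ys\<leftarrow>deletions xs. of_bool (alternating_list b ys)) +
     of_bool (alternating_list b xs) + of_bool (alternating_list (\<not> b) xs) :: nat)"
  using assms
proof (induction xs arbitrary: b)
  case (Cons x xs)
  have IH: "even ((\<Sum>ys\<leftarrow>deletions xs. of_bool (alternating_list (\<not> b) ys)) +
     of_bool (alternating_list (\<not> b) xs) + of_bool (alternating_list b xs) :: nat)"
    using Cons.IH[of "\<not> b"] Cons.prems by auto
  show ?case
  proof (cases "\<forall>y\<in>set xs. \<bar>x\<bar> < \<bar>y\<bar>")
    case True
    have *: "map (\<lambda>ys. of_bool (alternating_list b (x # ys)) :: nat) (deletions xs) =
        map (\<lambda>ys. of_bool ((0 < x) = b) * of_bool (alternating_list (\<not> b) ys)) (deletions xs)"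
      using True set_deletions by (force simp: of_bool_def)
    have "(\<Sum>ys\<leftarrow>deletions xs. of_bool (alternating_list b (x # ys)) :: nat) =
       of_bool ((0 < x) = b) * (\<Sum>ys\<leftarrow>deletions xs. of_bool (alternating_list (\<not> b) ys))"
      unfolding * by (simp add: sum_list_const_mult)
    then show ?thesis using True IH by (auto simp: comp_def)
  next
    case False
    then obtain y where y: "y \<in> set xs" "\<bar>y\<bar> \<le> \<bar>x\<bar>" by (auto simp: not_less)
    then obtain z zs where xs: "xs = z # zs" by (cases xs) auto
    have "\<bar>z\<bar> \<le> \<bar>x\<bar>" using y Cons.prems(1) xs by auto
    moreover have "\<bar>x\<bar> \<le> \<bar>z\<bar>" using Cons.prems(1) xs by auto
    ultimately have zx: "z = x" using Cons.prems(2) xs by (auto simp: abs_eq_iff)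
    have "(\<Sum>ys\<leftarrow>deletions zs. of_bool (alternating_list b (x # x # ys)) :: nat) = 0"
      by (simp add: sum_list_eq_0_iff)
    then show ?thesis unfolding xs zx by (simp add: comp_def)
  qed
qed simp

lemma even_deletions:
  assumes "\<forall>x\<in>#M. x \<noteq> 0 \<and> - x \<notin># M"
  shows "even ((\<Sum>x\<in>#M. of_bool (alternating b (M - {#x#}))) +
     of_bool (alternating b M) + of_bool (alternating (\<not> b) M) :: nat)"
proof -
  obtain xs0 where "mset xs0 = M" using ex_mset by blast
  define xs where "xs = sort_key abs xs0"
  have M: "mset xs = M" and sorted: "sorted (map abs xs)"
    using \<open>mset xs0 = M\<close> by (auto simp: xs_def)
  have nc: "\<forall>x\<in>set xs. x \<noteq> 0 \<and> - x \<notin> set xs" using assms M by auto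
  have "(\<Sum>x\<in>#M. of_bool (alternating b (M - {#x#})) :: nat)
      = (\<Sum>N\<leftarrow>map mset (deletions xs). of_bool (alternating b N))"
    unfolding mset_deletions
    by (simp add: M comp_def flip: sum_mset_sum_list)
  also have "\<dots> = (\<Sum>ys\<leftarrow>deletions xs. of_bool (alternating b (mset ys)))"
    by (simp add: comp_def)
  also have "\<dots> = (\<Sum>ys\<leftarrow>deletions xs. of_bool (alternating_list b ys))"
  proof (intro arg_cong[where f = sum_list] map_cong refl)
    fix ys assume ys: "ys \<in> set (deletions xs)"
    have "alternating b (mset ys) \<longleftrightarrow> alternating_list b ys"
      by (rule alternating_mset_iff)
        (use set_deletions[OF ys] sorted_deletions[OF ys sorted] nc in blast)+
    then show "of_bool (alternating b (mset ys)) = (of_bool (alternating_list b ys) :: nat)"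
      by simp
  qed
  finally show ?thesis
    using even_deletions_list[OF sorted nc, of b] alternating_mset_iff[OF sorted nc]
    by (simp add: M)
qed

lemma even_sum_involution:
  fixes f :: "'a \<Rightarrow> nat"
  assumes "finite A"
    and "\<And>x. x \<in> A \<Longrightarrow> h x \<in> A \<and> h (h x) = x \<and> h x \<noteq> x \<and> f (h x) = f x"
  shows "even (sum f A)"
  using assms
proof (induction A rule: finite_psubset_induct)
  case (psubset A)
  show ?case
  proof (cases "A = {}")
    case False
    then obtain x where x: "x \<in> A" by blast
    define B where "B = A - {x, h x}"
    have "B \<subset> A" using x by (auto simp: B_def)
    moreover have "h y \<in> B \<and> h (h y) = y \<and> h y \<noteq> y \<and> f (h y) = f y" if "y \<in> B" for y
      using that psubset.prems[of y] psubset.prems[OF x] by (auto simp: B_def)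
    ultimately have "even (sum f B)" using psubset.IH by blast
    moreover have "sum f A = sum f B + sum f {x, h x}"
      unfolding B_def
      using psubset.prems[OF x] x psubset.hyps
      by (metis add.commute empty_subsetI insert_subset sum.subset_diff)
    moreover have "sum f {x, h x} = 2 * f x" using psubset.prems[OF x] by (auto simp: mult_2)
    ultimately show ?thesis by simp
  qed simp
qed


text \<open>The vertices of the \<open>d\<close>-dimensional cross-polytope are the literals \<open>i\<close> and \<open>- i\<close> with
  \<open>i \<in> {1..d}\<close>. A maximal simplex of the barycentric subdivision of its boundary is a maximal chain of
  faces, encoded here as the list whose nonempty prefixes are these faces.\<close>

definition literal_lists :: "nat \<Rightarrow> int list set" where
  "literal_lists d = {xs. distinct (map abs xs) \<and> abs ` set xs = int ` {1..d}}"

text \<open>The face of the simplex \<open>xs\<close> spanned by the prefixes with index in \<open>I\<close>; its facet opposite to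
  vertex \<open>i\<close> is obtained by leaving out the index \<open>i\<close>.\<close>

definition facet_labels :: "(int set \<Rightarrow> int) \<Rightarrow> nat set \<Rightarrow> int list \<Rightarrow> int multiset" where
  "facet_labels lab I xs = image_mset (\<lambda>k. lab (set (take (Suc k) xs))) (mset_set I)"

text \<open>The second maximal simplex that shares with \<open>xs\<close> the facet opposite to vertex \<open>i\<close>, for \<open>i\<close> not
  the last index.\<close>

definition swap_next :: "nat \<Rightarrow> 'a list \<Rightarrow> 'a list" where
  "swap_next i xs = xs[i := xs ! Suc i, Suc i := xs ! i]"

lemma length_literal_list:
  assumes "xs \<in> literal_lists d"
  shows "length xs = d"
proof -
  have "card (set (map abs xs)) = length xs"
    using assms distinct_card[of "map abs xs"] by (auto simp: literal_lists_def)
  moreover have "card (set (map abs xs)) = d"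
    using assms by (simp add: literal_lists_def card_image)
  ultimately show ?thesis by simp
qed

lemma finite_literal_lists: "finite (literal_lists d)"
proof (rule finite_subset)
  show "literal_lists d \<subseteq> {xs. set xs \<subseteq> {- int d..int d} \<and> length xs = d}"
  proof safe
    fix xs x assume xs: "xs \<in> literal_lists d" "x \<in> set xs"
    then have "\<bar>x\<bar> \<in> int ` {1..d}" unfolding literal_lists_def by blast
    then show "x \<in> {- int d..int d}" by auto
  qed (simp add: length_literal_list)
  show "finite {xs. set xs \<subseteq> {- int d..int d} \<and> length xs = d}"
    by (rule finite_lists_length_eq) simp
qed

lemma literal_list_cong:
  assumes "xs \<in> literal_lists d" "mset (map abs ys) = mset (map abs xs)"
  shows "ys \<in> literal_lists d"
proof -
  have "distinct (map abs ys)"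
    using assms by (metis (no_types, lifting) literal_lists_def mem_Collect_eq mset_eq_imp_distinct_iff)
  moreover have "set (map abs ys) = set (map abs xs)"
    using assms(2) mset_eq_setD by blast
  ultimately show ?thesis using assms(1) by (simp add: literal_lists_def)
qed

lemma facet_labels_cong:
  assumes "finite I" "\<And>k. k \<in> I \<Longrightarrow> set (take (Suc k) xs) = set (take (Suc k) ys)"
  shows "facet_labels lab I xs = facet_labels lab I ys"
  unfolding facet_labels_def by (rule image_mset_cong) (use assms in auto)

lemma facet_labels_remove:
  assumes "finite I" "i \<in> I"
  shows "facet_labels lab (I - {i}) xs
    = facet_labels lab I xs - {#lab (set (take (Suc i) xs))#}"
proof -
  have "mset_set I = add_mset i (mset_set (I - {i}))"
    using mset_set.remove[OF assms] .
  then show ?thesis by (simp add: facet_labels_def)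
qed

lemma swap_next_literal_list:
  assumes xs: "xs \<in> literal_lists d" and i: "Suc i < d"
  shows "swap_next i xs \<in> literal_lists d" "swap_next i (swap_next i xs) = xs"
    "swap_next i xs \<noteq> xs" "set (swap_next i xs) = set xs"
proof -
  have len: "length xs = d" by (rule length_literal_list[OF xs])
  have "mset (swap_next i xs) = mset xs"
    using i len by (simp add: swap_next_def mset_swap)
  then show "swap_next i xs \<in> literal_lists d"
    using literal_list_cong[OF xs, of "swap_next i xs"] by simp
  show "set (swap_next i xs) = set xs"
    using \<open>mset (swap_next i xs) = mset xs\<close> mset_eq_setD by blast
  show "swap_next i (swap_next i xs) = xs"
    by (rule nth_equalityI) (use i len in \<open>auto simp: swap_next_def nth_list_update\<close>)
  have "distinct xs" using xs by (auto simp: literal_lists_def distinct_map)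
  then have "xs ! i \<noteq> xs ! Suc i" using i len by (simp add: nth_eq_iff_index_eq)
  then have "swap_next i xs ! i \<noteq> xs ! i" using i len by (simp add: swap_next_def)
  then show "swap_next i xs \<noteq> xs" by metis
qed

lemma set_take_swap_next:
  assumes "Suc i < length xs" "k \<noteq> i" "k < length xs"
  shows "set (take (Suc k) (swap_next i xs)) = set (take (Suc k) xs)"
proof (cases "k < i")
  case True
  then show ?thesis by (simp add: swap_next_def)
next
  case False
  then have "i < k" using assms by simp
  then have "take (Suc k) (swap_next i xs) = swap_next i (take (Suc k) xs)"
    by (simp add: swap_next_def take_update_swap)
  moreover have "set (swap_next i (take (Suc k) xs)) = set (take (Suc k) xs)"
    unfolding swap_next_def by (rule set_swap) (use \<open>i < k\<close> assms in auto)
  ultimately show ?thesis by simp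
qed

text \<open>The faces of the \<open>n\<close>-dimensional cross-polytope.\<close>

definition consistent :: "nat \<Rightarrow> int set \<Rightarrow> bool" where
  "consistent n A \<longleftrightarrow> A \<noteq> {} \<and> abs ` A \<subseteq> int ` {1..n} \<and> (\<forall>x\<in>A. - x \<notin> A)"

lemma consistent_prefix:
  assumes xs: "xs \<in> literal_lists d" and "k < d" "d \<le> n"
  shows "consistent n (set (take (Suc k) xs))"
proof -
  have sub: "set (take (Suc k) xs) \<subseteq> set xs" by (rule set_take_subset)
  have ab: "abs ` set xs = int ` {1..d}" and inj: "inj_on abs (set xs)"
    using xs by (auto simp: literal_lists_def distinct_map)
  have "abs ` set (take (Suc k) xs) \<subseteq> int ` {1..n}"
    using sub ab assms(3) by fastforce
  moreover have "- x \<notin> set (take (Suc k) xs)" if "x \<in> set (take (Suc k) xs)" for x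
  proof
    assume "- x \<in> set (take (Suc k) xs)"
    then have "- x = x" using inj sub that by (metis abs_minus_cancel inj_onD subsetD)
    moreover have "\<bar>x\<bar> \<in> int ` {1..d}" using sub that ab by blast
    ultimately show False by auto
  qed
  moreover have "set (take (Suc k) xs) \<noteq> {}"
    using length_literal_list[OF xs] assms(2) by auto
  ultimately show ?thesis by (simp add: consistent_def)
qed

text \<open>The hypotheses of Ky Fan's lemma: an antipodal labelling of the vertices of the barycentric
  subdivision that gives no edge complementary labels.\<close>

locale antipodal_labelling =
  fixes n :: nat and lab :: "int set \<Rightarrow> int"
  assumes lab_nonzero: "consistent n A \<Longrightarrow> lab A \<noteq> 0"
    and lab_uminus: "consistent n A \<Longrightarrow> lab (uminus ` A) = - lab A"
    and lab_comparable: "consistent n A \<Longrightarrow> consistent n B \<Longrightarrow> A \<subseteq> B \<Longrightarrow> lab A \<noteq> - lab B"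
begin

definition num_alternating :: "bool \<Rightarrow> nat \<Rightarrow> nat" where
  "num_alternating b d = (\<Sum>xs\<in>literal_lists d. of_bool (alternating b (facet_labels lab {..<d} xs)))"

lemma labels_no_complement:
  assumes "xs \<in> literal_lists d" "d \<le> n"
  shows "\<forall>x\<in>#facet_labels lab {..<d} xs. x \<noteq> 0 \<and> - x \<notin># facet_labels lab {..<d} xs"
proof -
  have "lab (set (take (Suc k) xs)) \<noteq> 0" if "k < d" for k
    using lab_nonzero consistent_prefix[OF assms(1) that assms(2)] by blast
  moreover have "- lab (set (take (Suc k) xs)) \<noteq> lab (set (take (Suc l) xs))"
    if "k < d" "l < d" for k l
  proof (cases "k \<le> l")
    case True
    then have "set (take (Suc k) xs) \<subseteq> set (take (Suc l) xs)"
      by (intro set_take_subset_set_take) simp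
    then show ?thesis
      using lab_comparable consistent_prefix assms that by (metis minus_equation_iff)
  next
    case False
    then have "set (take (Suc l) xs) \<subseteq> set (take (Suc k) xs)"
      by (intro set_take_subset_set_take) simp
    then show ?thesis
      using lab_comparable consistent_prefix assms that by metis
  qed
  ultimately show ?thesis by (auto simp: facet_labels_def)
qed

lemma uminus_literal_list:
  assumes "xs \<in> literal_lists d"
  shows "map uminus xs \<in> literal_lists d"
  by (rule literal_list_cong[OF assms]) (simp add: comp_def)

lemma facet_labels_uminus:
  assumes "xs \<in> literal_lists d" "d \<le> n"
  shows "facet_labels lab {..<d} (map uminus xs) = image_mset uminus (facet_labels lab {..<d} xs)"
proof -
  have "lab (set (take (Suc k) (map uminus xs))) = - lab (set (take (Suc k) xs))" if "k < d" for k
    using lab_uminus[OF consistent_prefix[OF assms(1) that assms(2)]] by (simp add: take_map)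
  then show ?thesis
    unfolding facet_labels_def by (simp add: image_mset.compositionality comp_def) (rule image_mset_cong, simp)
qed

text \<open>Half of the sphere is enough: a simplex in the lower hemisphere that alternates with leading sign
  \<open>b\<close> is the antipode of one in the upper hemisphere \<open>H\<close> with the other leading sign. By
  \<open>even_deletions\<close> the number sought has the parity of the number of pairs of a simplex in
  \<open>H\<close> and an alternating facet of it. Facets inside \<open>H\<close> lie in two simplices of \<open>H\<close> and cancel;
  the facets on the equator, which is the sphere of one dimension less, lie in a single one.\<close>

lemma num_alternating_Suc:
  assumes d: "Suc d \<le> n"
  shows "even (num_alternating b (Suc d) + num_alternating b d)"
proof -
  let ?L = "literal_lists (Suc d)"
  let ?a = "\<lambda>b xs. of_bool (alternating b (facet_labels lab {..<Suc d} xs)) :: nat"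
  let ?f = "\<lambda>i xs. of_bool (alternating b (facet_labels lab ({..<Suc d} - {i}) xs)) :: nat"
  define D where "D = int (Suc d)"
  have D: "D > 0" "D \<notin> int ` {1..d}" "int ` {1..Suc d} = insert D (int ` {1..d})"
    by (auto simp: D_def atLeastAtMostSuc_conv)
  define H where "H = {xs \<in> ?L. D \<in> set xs}"
  have finH: "finite H" by (simp add: H_def finite_literal_lists)
  have either: "D \<in> set xs \<longleftrightarrow> - D \<notin> set xs" if "xs \<in> ?L" for xs
  proof -
    have ab: "abs ` set xs = int ` {1..Suc d}" and inj: "inj_on abs (set xs)"
      using that by (auto simp: literal_lists_def distinct_map)
    have "D \<in> abs ` set xs" unfolding ab D by simp
    then obtain x where "x \<in> set xs" "\<bar>x\<bar> = D" by force
    then have "D \<in> set xs \<or> - D \<in> set xs"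
      by (cases "x \<ge> 0") auto
    moreover have "\<not> (D \<in> set xs \<and> - D \<in> set xs)"
      using inj_onD[OF inj, of D "- D"] D(1) by auto
    ultimately show ?thesis by blast
  qed
  have lower: "sum (?a b) (?L - H) = sum (?a (\<not> b)) H"
  proof (rule sum.reindex_bij_witness[where i = "map uminus" and j = "map uminus"])
    fix xs assume xs: "xs \<in> ?L - H"
    then show "map uminus xs \<in> H"
      using either[of xs] uminus_literal_list[of xs]
      by (auto simp: H_def intro!: image_eqI[where x = "- D"])
    have "0 \<notin># facet_labels lab {..<Suc d} xs"
      using labels_no_complement[of xs] xs d by auto
    then show "?a (\<not> b) (map uminus xs) = ?a b xs"
      using xs d by (simp add: facet_labels_uminus alternating_uminus)
  next
    fix xs assume xs: "xs \<in> H"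
    then have "- D \<notin> set xs" using either by (auto simp: H_def)
    then have "D \<notin> uminus ` set xs" by (metis imageE minus_minus)
    then show "map uminus xs \<in> ?L - H"
      using xs uminus_literal_list[of xs] by (auto simp: H_def)
  qed (auto simp: comp_def)
  have "num_alternating b (Suc d) = sum (?a b) H + sum (?a b) (?L - H)"
    unfolding num_alternating_def using finite_literal_lists
    by (subst sum.subset_diff[of H]) (auto simp: H_def)
  then have total: "num_alternating b (Suc d) = (\<Sum>xs\<in>H. ?a b xs + ?a (\<not> b) xs)"
    by (simp add: lower sum.distrib)
  have facets: "even ((\<Sum>i<Suc d. ?f i xs) + ?a b xs + ?a (\<not> b) xs)" if "xs \<in> H" for xs
  proof -
    have "(\<Sum>i<Suc d. ?f i xs) = (\<Sum>i<Suc d. of_bool (alternating b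
        (facet_labels lab {..<Suc d} xs - {#lab (set (take (Suc i) xs))#})))"
      by (intro sum.cong refl) (simp add: facet_labels_remove)
    also have "\<dots> = (\<Sum>x\<in>#facet_labels lab {..<Suc d} xs.
        of_bool (alternating b (facet_labels lab {..<Suc d} xs - {#x#})))"
      unfolding sum_unfold_sum_mset 
      by (simp add: facet_labels_def image_mset.compositionality comp_def)
    finally show ?thesis
      using even_deletions[OF labels_no_complement[of xs "Suc d"]] that d
      by (simp add: H_def)
  qed
  have "even (\<Sum>xs\<in>H. (\<Sum>i<Suc d. ?f i xs) + ?a b xs + ?a (\<not> b) xs)"
    by (rule dvd_sum) (rule facets)
  then have "even ((\<Sum>xs\<in>H. \<Sum>i<Suc d. ?f i xs) + num_alternating b (Suc d))"
    unfolding total sum.distrib add.assoc .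
  then have A: "even ((\<Sum>i<Suc d. \<Sum>xs\<in>H. ?f i xs) + num_alternating b (Suc d))"
    by (subst sum.swap)
  \<comment> \<open>a facet that misses a vertex other than the last is shared by the simplex with two neighbouring literals exchanged\<close>
  have inner: "even (\<Sum>xs\<in>H. ?f i xs)" if "i < d" for i
  proof (rule even_sum_involution[OF finH, where h = "swap_next i"])
    fix xs assume xs: "xs \<in> H"
    then have xsL: "xs \<in> ?L" by (simp add: H_def)
    note len = length_literal_list[OF xsL]
    have "facet_labels lab ({..<Suc d} - {i}) (swap_next i xs) = facet_labels lab ({..<Suc d} - {i}) xs"
      by (rule facet_labels_cong) (use that len in \<open>auto simp: set_take_swap_next\<close>)
    then show "swap_next i xs \<in> H \<and> swap_next i (swap_next i xs) = xs \<and> swap_next i xs \<noteq> xs \<and>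
        ?f i (swap_next i xs) = ?f i xs"
      using swap_next_literal_list[OF xsL, of i] that xs by (simp add: H_def)
  qed
  \<comment> \<open>the simplices of \<open>H\<close> with a facet on the equator: the literal \<open>D\<close> comes last\<close>
  define C where "C = (\<lambda>ys. ys @ [D]) ` literal_lists d"
  have CH: "C \<subseteq> H"
  proof
    fix xs assume "xs \<in> C"
    then obtain ys where ys: "ys \<in> literal_lists d" "xs = ys @ [D]" by (auto simp: C_def)
    then show "xs \<in> H" using D by (auto simp: H_def literal_lists_def)
  qed
  \<comment> \<open>all other simplices share the facet opposite to the last vertex with the simplex in which the last literal is negated\<close>
  have outer: "even (\<Sum>xs\<in>H - C. ?f d xs)"
  proof (rule even_sum_involution[where h = "\<lambda>xs. xs[d := - xs ! d]"])
    fix xs assume xs: "xs \<in> H - C"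
    then have xsL: "xs \<in> ?L" by (simp add: H_def)
    note len = length_literal_list[OF xsL]
    have split: "xs = take d xs @ [xs ! d]"
      using len by (metis lessI take_Suc_conv_app_nth take_all_iff order_refl)
    have inj: "inj_on abs (set xs)" "distinct (map abs xs)" and ab: "abs ` set xs = int ` {1..Suc d}"
      using xsL by (auto simp: literal_lists_def distinct_map)
    have ne: "xs ! d \<noteq> D"
    proof
      assume eq: "xs ! d = D"
      have xs': "xs = take d xs @ [D]" by (rule split[unfolded eq])
      have "distinct (map abs (take d xs))" using distinct_take[OF inj(2), of d] by (simp add: take_map)
      moreover have "abs ` set (take d xs) = int ` {1..d}"
      proof -
        have "set xs = insert D (set (take d xs))" using arg_cong[OF xs', of set] by simp
        then have "insert D (abs ` set (take d xs)) = insert D (int ` {1..d})"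
          using ab D by simp
        moreover have "D \<notin> abs ` set (take d xs)"
        proof -
          have "distinct (map abs (take d xs @ [D]))" using inj(2) xs' by metis
          then show ?thesis using D(1) by auto
        qed
        ultimately show ?thesis using D(2) by (simp add: insert_ident)
      qed
      ultimately have "take d xs \<in> literal_lists d" by (simp add: literal_lists_def)
      then have "xs \<in> C" using xs' unfolding C_def by blast
      then show False using xs by blast
    qed
    let ?h = "xs[d := - xs ! d]"
    have "map abs ?h = map abs xs"
      using len by (auto simp: list_eq_iff_nth_eq nth_list_update)
    then have hL: "?h \<in> ?L" using literal_list_cong[OF xsL, of ?h] by simp
    have "D \<in> set (take d xs)"
      using xs ne arg_cong[OF split, of set] by (auto simp: H_def)
    then have "D \<in> set (take d ?h)" by simp
    then have hH: "?h \<in> H" using hL in_set_takeD unfolding H_def by fast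
    have nz: "xs ! d \<noteq> 0"
    proof -
      have "\<bar>xs ! d\<bar> \<in> int ` {1..Suc d}" using ab len by (metis imageI lessI nth_mem)
      then show ?thesis by auto
    qed
    have "?h \<notin> C"
    proof
      assume "?h \<in> C"
      then obtain ys where ys: "?h = ys @ [D]" "ys \<in> literal_lists d" by (auto simp: C_def)
      have "?h ! d = D" unfolding ys(1) using length_literal_list[OF ys(2)] by (simp add: nth_append)
      then have "xs ! d = - D" using len by simp
      then have "- D \<in> set xs" using len by (metis lessI nth_mem)
      then show False using either[OF xsL] xs by (simp add: H_def)
    qed
    moreover have "?h \<noteq> xs"
      using len nz by (simp add: list_update_same_conv)
    moreover have "facet_labels lab ({..<Suc d} - {d}) ?h = facet_labels lab ({..<Suc d} - {d}) xs"
      by (rule facet_labels_cong) auto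
    ultimately show "?h \<in> H - C \<and> ?h[d := - ?h ! d] = xs \<and> ?h \<noteq> xs \<and> ?f d ?h = ?f d xs"
      using hH len by simp
  qed (use finH in simp)
  have "(\<Sum>xs\<in>C. ?f d xs) = (\<Sum>ys\<in>literal_lists d. ?f d (ys @ [D]))"
    unfolding C_def by (subst sum.reindex) (auto simp: inj_on_def)
  also have "\<dots> = num_alternating b d"
    unfolding num_alternating_def
  proof (intro sum.cong refl)
    fix ys assume ys: "ys \<in> literal_lists d"
    have "facet_labels lab ({..<Suc d} - {d}) (ys @ [D]) = facet_labels lab {..<d} (ys @ [D])"
      by (simp add: lessThan_Suc)
    also have "\<dots> = facet_labels lab {..<d} ys"
      by (rule facet_labels_cong) (use length_literal_list[OF ys] in auto)
    finally show "?f d (ys @ [D]) = of_bool (alternating b (facet_labels lab {..<d} ys))"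
      by simp
  qed
  finally have "(\<Sum>xs\<in>H. ?f d xs) = (\<Sum>xs\<in>H - C. ?f d xs) + num_alternating b d"
    using sum.subset_diff[OF CH finH, of "?f d"] by (simp only:)
  then have "even ((\<Sum>xs\<in>H. ?f d xs) + num_alternating b d)"
    using outer by (simp only: even_add simp_thms)
  moreover have "even (\<Sum>i<d. \<Sum>xs\<in>H. ?f i xs)" by (rule dvd_sum) (rule inner, simp)
  ultimately show ?thesis using A unfolding sum.lessThan_Suc even_add by blast
qed

lemma odd_num_alternating: "d \<le> n \<Longrightarrow> odd (num_alternating b d)"
proof (induction d)
  case 0
  have "literal_lists 0 = {[]}" by (auto simp: literal_lists_def)
  moreover have "alternating b {#}" by (auto simp: alternating_def intro: exI[of _ "[]"])
  ultimately show ?case by (simp add: num_alternating_def facet_labels_def)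
next
  case (Suc d)
  then show ?case using num_alternating_Suc[of d b] by simp
qed

text \<open>Tucker's lemma: an alternating simplex carries \<open>n\<close> labels of distinct absolute values, and the
  number of such simplices is odd.\<close>

lemma exists_large_label:
  assumes "n > 0"
  shows "\<exists>A. consistent n A \<and> int n \<le> \<bar>lab A\<bar>"
proof -
  have "num_alternating True n > 0" by (rule odd_pos, rule odd_num_alternating, rule order_refl)
  then have "\<exists>xs\<in>literal_lists n. alternating True (facet_labels lab {..<n} xs)"
    by (rule contrapos_pp) (simp add: num_alternating_def)
  then obtain xs where xs: "xs \<in> literal_lists n" "alternating True (facet_labels lab {..<n} xs)"
    by blast
  then obtain ls where ls: "mset ls = facet_labels lab {..<n} xs" "alternating_list True ls"
    by (auto simp: alternating_def)
  have card: "card (abs ` set ls) = n"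
  proof -
    have "length ls = n" using arg_cong[OF ls(1), of size] by (simp add: facet_labels_def)
    then show ?thesis
      using alternating_list_sorted(2)[OF ls(2)] distinct_card[of "map abs ls"] by simp
  qed
  have set: "set ls = (\<lambda>k. lab (set (take (Suc k) xs))) ` {..<n}"
    using arg_cong[OF ls(1), of set_mset] by (simp add: facet_labels_def)
  show ?thesis
  proof (rule ccontr)
    assume "\<not> ?thesis"
    then have "\<bar>lab A\<bar> \<in> {1..int n - 1}" if "consistent n A" for A
      using lab_nonzero[OF that] that by (auto simp: not_le)
    then have "abs ` set ls \<subseteq> {1..int n - 1}"
      unfolding set using consistent_prefix[OF xs(1) _ order_refl] by blast
    then have "card (abs ` set ls) \<le> card {1..int n - 1}" by (intro card_mono) auto
    then show False using card assms by simp
  qed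
qed

end


section \<open>Nearly antipodal points of one colour\<close>

text \<open>Suppose that subsets of \<open>I\<close> which differ in at least \<open>n - r\<close> places always have different colours.
  A pair of disjoint subsets of \<open>I\<close>, that is, a face of the cross-polytope, is labelled by its
  size if it has less than \<open>n - r\<close> elements. Otherwise both members have different colours, and
  the label is \<open>n - r\<close> plus the smaller colour; the sign tells which member has it. These labels are
  antipodal and without complementary edges, but their absolute values stay below \<open>n\<close>.\<close>

lemma cube_near_antipodal:
  fixes c :: "'a set \<Rightarrow> nat"
  assumes "finite I" and c: "c ` Pow I \<subseteq> {..<r}"
  obtains A B where "A \<subseteq> I" "B \<subseteq> I" "c A = c B" "card I \<le> card ((A - B) \<union> (B - A)) + r"
proof -
  define n where "n = card I"
  have "\<exists>A B. A \<subseteq> I \<and> B \<subseteq> I \<and> c A = c B \<and> n \<le> card ((A - B) \<union> (B - A)) + r"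
  proof (rule ccontr)
    assume "\<not> ?thesis"
    then have far: "card ((A - B) \<union> (B - A)) + r < n" if "A \<subseteq> I" "B \<subseteq> I" "c A = c B" for A B
      using that by (meson not_le)
    have rn: "r < n" using far[of "{}" "{}"] by simp
    obtain h where h: "bij_betw h {1..n} I"
      using assms(1) ex_bij_betw_nat_finite_1 unfolding n_def by blast
    define P where "P A = h ` {k \<in> {1..n}. int k \<in> A}" for A
    define N where "N A = P (uminus ` A)" for A
    have inj: "inj_on h {1..n}" and img: "h ` {1..n} = I"
      using h by (auto simp: bij_betw_def)
    have PI: "P A \<subseteq> I" "N A \<subseteq> I" for A using img by (auto simp: P_def N_def)
    have uu: "uminus ` uminus ` A = A" for A :: "int set" by (auto simp: image_image)
    have um: "y \<in> uminus ` A \<longleftrightarrow> - y \<in> A" for y :: int and A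
      by (force intro: image_eqI[where x = "- y"])
    have PN: "P (uminus ` A) = N A" "N (uminus ` A) = P A" for A
      by (simp_all add: N_def uu)
    have mono: "P A \<subseteq> P B" "N A \<subseteq> N B" if "A \<subseteq> B" for A B
      using that by (auto simp: P_def N_def)
    have cardP: "card (P A) = card {k \<in> {1..n}. int k \<in> A}" for A
      unfolding P_def by (rule card_image) (rule inj_on_subset[OF inj], blast)
    have cardPN: "card (P A) + card (N A) = card A" if "consistent n A" for A
    proof -
      let ?p = "{k \<in> {1..n}. int k \<in> A}" and ?m = "{k \<in> {1..n}. int k \<in> uminus ` A}"
      have A: "A = int ` ?p \<union> (\<lambda>k. - int k) ` ?m"
      proof (intro equalityI subsetI)
        fix x assume x: "x \<in> A"
        then have "\<bar>x\<bar> \<in> int ` {1..n}" using that by (auto simp: consistent_def)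
        then obtain k where k: "k \<in> {1..n}" "\<bar>x\<bar> = int k" by blast
        then have "x = int k \<or> x = - int k" by linarith
        then show "x \<in> int ` ?p \<union> (\<lambda>k. - int k) ` ?m"
          using k x by (auto simp: um)
      qed (auto simp: um)
      have "card A = card (int ` ?p) + card ((\<lambda>k. - int k) ` ?m)"
        by (subst A, rule card_Un_disjoint) auto
      also have "\<dots> = card ?p + card ?m"
        by (simp add: card_image inj_on_def)
      finally show ?thesis by (simp add: cardP N_def)
    qed
    have disj: "P A \<inter> N B = {}" if "consistent n B" "A \<subseteq> B" for A B
    proof -
      have "k \<notin> uminus ` B" if "k \<in> A" for k
        using that \<open>A \<subseteq> B\<close> \<open>consistent n B\<close> by (auto simp: consistent_def)
      then show ?thesis
        using inj unfolding P_def N_def inj_on_def by blast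
    qed
    \<comment> \<open>nested large pairs: the first member of one and the second member of the other are still disjoint and together large\<close>
    have apart: "c (P A) \<noteq> c (N B)" "c (N A) \<noteq> c (P B)"
      if "consistent n A" "consistent n B" "A \<subseteq> B" "n \<le> card A + r" for A B
    proof -
      have fin: "finite (P A)" "finite (N A)" "finite (P B)" "finite (N B)"
        using PI finite_subset[OF _ assms(1)] by blast+
      have "consistent n (uminus ` B)"
        using that(2) by (auto simp: consistent_def um image_image)
      then have d: "P A \<inter> N B = {}" "N A \<inter> P B = {}"
        using disj[OF that(2,3)] disj[of "uminus ` B" "uminus ` A"] that(3)
        by (auto simp: PN image_mono)
      have "card (P A) + card (N A) \<le> card (P A) + card (N B)"
        "card (P A) + card (N A) \<le> card (N A) + card (P B)"
        using mono[OF that(3)] fin by (auto intro: card_mono)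
      moreover have "card ((P A - N B) \<union> (N B - P A)) = card (P A) + card (N B)"
        "card ((N A - P B) \<union> (P B - N A)) = card (N A) + card (P B)"
        using d fin by (auto simp: Diff_triv Int_commute card_Un_disjoint)
      ultimately show "c (P A) \<noteq> c (N B)" "c (N A) \<noteq> c (P B)"
        using far[of "P A" "N B"] far[of "N A" "P B"] PI cardPN[OF that(1)] that(4)
        by (metis add_le_mono1 le_trans not_le)+
    qed
    \<comment> \<open>any odd choice of sign works for small faces: take the sign of the literal of largest absolute value\<close>
    define s :: "int set \<Rightarrow> int" where "s A = (if Max (abs ` A) \<in> A then 1 else - 1)" for A
    define lab :: "int set \<Rightarrow> int" where
      "lab A = (if card A + r < n then s A * int (card A)
        else if c (P A) < c (N A) then int (n - r + c (P A)) else - int (n - r + c (N A)))" for A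
    have cardpos: "card A > 0" if "consistent n A" for A
    proof -
      have "finite (abs ` A)" using that unfolding consistent_def by (meson finite_imageI finite_atLeastAtMost finite_subset)
      moreover have "inj_on abs A" using that by (auto simp: consistent_def inj_on_def abs_eq_iff)
      ultimately have "finite A" using finite_imageD by blast
      then show ?thesis using that by (auto simp: consistent_def card_gt_0_iff)
    qed
    have finA: "finite A" if "consistent n A" for A using cardpos[OF that] by (rule card_ge_0_finite)
    have s_uminus: "s (uminus ` A) = - s A" if "consistent n A" for A
    proof -
      have "Max (abs ` A) \<in> abs ` A"
        using finA[OF that] that by (intro Max_in) (auto simp: consistent_def)
      then obtain x where x: "x \<in> A" "Max (abs ` A) = \<bar>x\<bar>" by blast
      have "abs ` uminus ` A = abs ` A" by (auto simp: image_image)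
      moreover have "\<bar>x\<bar> \<in> uminus ` A \<longleftrightarrow> \<bar>x\<bar> \<notin> A"
        using that x(1) unfolding consistent_def by (cases "x \<ge> 0") (auto simp: um)
      ultimately show ?thesis by (simp add: s_def x(2))
    qed
    have abs_small: "\<bar>lab A\<bar> = int (card A)" if "card A + r < n" for A
      using that by (simp add: lab_def s_def)
    have abs_large: "\<bar>lab A\<bar> = int (n - r + min (c (P A)) (c (N A)))" if "\<not> card A + r < n" for A
      using that by (auto simp: lab_def)
    interpret antipodal_labelling n lab
    proof
      fix A assume A: "consistent n A"
      show "lab A \<noteq> 0"
        using cardpos[OF A] rn by (auto simp: lab_def s_def)
      have "c (P A) \<noteq> c (N A)" if "\<not> card A + r < n"
        using apart(1)[OF A A] that by simp
      then show "lab (uminus ` A) = - lab A"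
        using s_uminus[OF A] by (auto simp: lab_def PN card_image)
      fix B assume B: "consistent n B" "A \<subseteq> B"
      have le: "card A \<le> card B" using card_mono[OF finA[OF B(1)] B(2)] .
      show "lab A \<noteq> - lab B"
      proof
        assume eq: "lab A = - lab B"
        then have abs: "\<bar>lab A\<bar> = \<bar>lab B\<bar>" by simp
        consider "card A + r < n" "card B + r < n" | "card A + r < n" "\<not> card B + r < n"
          | "\<not> card A + r < n" "\<not> card B + r < n" using le by linarith
        then show False
        proof cases
          case 1
          then have "card A = card B" using abs by (simp add: abs_small)
          then have "A = B" using card_subset_eq[OF finA[OF B(1)] B(2)] by blast
          then show False using eq \<open>lab A \<noteq> 0\<close> by simp
        next
          case 2
          then show False using abs by (simp add: abs_small abs_large)
        next
          case 3
          then have "c (P A) \<noteq> c (N B)" "c (N A) \<noteq> c (P B)" using apart[OF A B] by auto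
          then show False
            using eq 3 rn by (auto simp: lab_def split: if_splits)
        qed
      qed
    qed
    obtain A where A: "consistent n A" "int n \<le> \<bar>lab A\<bar>"
      using exists_large_label rn by auto
    have "c (P A) < r" "c (N A) < r" using c PI[of A] by blast+
    then have "\<bar>lab A\<bar> < int n"
      using rn by (cases "card A + r < n") (simp_all add: abs_small abs_large)
    then show False using A(2) by simp
  qed
  then show thesis using that unfolding n_def by blast
qed


section \<open>The group and the building blocks of the set\<close>

lemma carrier_Fp_omega:
  assumes "p > 0"
  shows "carrier (Fp_omega p) = {x. (\<forall>i. x i \<in> {0..<int p}) \<and> finite {i. x i \<noteq> 0}}"
  using assms
  by (auto simp: Fp_omega_def carrier_sum_group carrier_integer_mod_group PiE_iff)

lemma mult_Fp_omega [simp]: "x \<otimes>\<^bsub>Fp_omega p\<^esub> y = (\<lambda>i. (x i + y i) mod int p)"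
  by (simp add: Fp_omega_def restrict_def)

lemma one_Fp_omega [simp]: "\<one>\<^bsub>Fp_omega p\<^esub> = (\<lambda>i. 0)"
  by (simp add: Fp_omega_def restrict_def)

lemma group_Fp_omega: "group (Fp_omega p)"
  unfolding Fp_omega_def by (rule sum_group) simp

definition near_ones :: "nat \<Rightarrow> nat set \<Rightarrow> nat \<Rightarrow> (nat \<Rightarrow> int) set" where
  "near_ones p I k = {e. (\<forall>i. e i \<in> {0..<int p}) \<and> (\<forall>i. i \<notin> I \<longrightarrow> e i = 0) \<and>
     card {i \<in> I. e i \<noteq> 1} \<le> k}"

lemma near_ones_carrier:
  assumes "p > 0" "finite I"
  shows "near_ones p I k \<subseteq> carrier (Fp_omega p)"
proof
  fix e assume e: "e \<in> near_ones p I k"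
  then have "{i. e i \<noteq> 0} \<subseteq> I" by (auto simp: near_ones_def)
  then show "e \<in> carrier (Fp_omega p)"
    using e assms by (auto simp: near_ones_def carrier_Fp_omega intro: finite_subset)
qed

section \<open>Topological recurrence\<close>

text \<open>Every orbit is dense and therefore visits \<open>U\<close>; the rest is compactness.\<close>

lemma finite_translates_cover:
  assumes "compact_space X" "minimal_action G X T" "openin X U" "U \<noteq> {}"
  obtains K where "finite K" "K \<subseteq> carrier G" "\<And>x. x \<in> topspace X \<Longrightarrow> \<exists>h\<in>K. T h x \<in> U"
proof -
  have hom: "homeomorphic_map X X (T g)" if "g \<in> carrier G" for g
    using assms(2) that by (simp add: minimal_action_def)
  have dense: "X closure_of (orbit G T x) = topspace X" if "x \<in> topspace X" for x
    using assms(2) that by (simp add: minimal_action_def)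
  define V where "V h = {x \<in> topspace X. T h x \<in> U}" for h
  have "openin X (V h)" if "h \<in> carrier G" for h
    unfolding V_def
    by (rule openin_continuous_map_preimage[OF homeomorphic_imp_continuous_map[OF hom[OF that]] assms(3)])
  moreover have "topspace X \<subseteq> \<Union>(V ` carrier G)"
  proof
    fix x assume x: "x \<in> topspace X"
    obtain y where "y \<in> U" "y \<in> topspace X"
      using assms(3,4) openin_subset by blast
    then have "y \<in> X closure_of (orbit G T x)" using dense[OF x] by simp
    then obtain z where "z \<in> orbit G T x" "z \<in> U"
      using \<open>y \<in> U\<close> assms(3) by (auto simp: in_closure_of)
    then show "x \<in> \<Union>(V ` carrier G)" using x by (auto simp: orbit_def V_def)
  qed
  ultimately obtain F where F: "finite F" "F \<subseteq> V ` carrier G" "topspace X \<subseteq> \<Union>F"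
    using assms(1) unfolding compact_space_alt by (metis (no_types, lifting) imageE)
  then obtain K where "finite K" "K \<subseteq> carrier G" "F = V ` K"
    by (metis finite_subset_image)
  then show thesis using that[of K] F(3) by (auto simp: V_def)
qed

text \<open>Vectors over the integers modulo 2 are added by symmetric difference, so two subsets of
  \<open>I\<close> that differ almost everywhere differ by an element of \<open>near_ones 2 I k\<close>. Colouring \<open>A\<close> by a
  translate of \<open>U\<close> that contains the image of a fixed point under the indicator of \<open>A\<close>, a
  monochromatic pair of this kind yields a return of \<open>U\<close>.\<close>

lemma topological_recurrence_near_ones:
  assumes R: "\<And>r. \<exists>I k. finite I \<and> r \<le> k \<and> k < card I \<and> near_ones 2 I k \<subseteq> R"
  shows "topological_recurrence (Fp_omega 2) R"
  unfolding topological_recurrence_def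
proof (intro allI impI, elim conjE)
  fix X :: "real topology" and T U
  let ?G = "Fp_omega 2"
  assume X: "compact_space X" and T: "minimal_action ?G X T" and U: "openin X U" "U \<noteq> {}"
  obtain K where K: "finite K" "K \<subseteq> carrier ?G" "\<And>x. x \<in> topspace X \<Longrightarrow> \<exists>h\<in>K. T h x \<in> U"
    using finite_translates_cover[OF X T U] by blast
  interpret T: group_action ?G "topspace X" T
    using T by (simp add: minimal_action_def)
  obtain x where x: "x \<in> topspace X" using U openin_subset by blast
  obtain I k where I: "finite I" "card K \<le> k" "k < card I" "near_ones 2 I k \<subseteq> R"
    using R[of "card K"] by blast
  define v :: "nat set \<Rightarrow> nat \<Rightarrow> int" where "v A i = of_bool (i \<in> A)" for A i
  have vG: "v A \<in> carrier ?G" if "A \<subseteq> I" for A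
    using that finite_subset[OF that I(1)] by (auto simp: carrier_Fp_omega v_def)
  have TX: "T g y \<in> topspace X" if "g \<in> carrier ?G" "y \<in> topspace X" for g y
    using that T.element_image by blast
  define h where "h A = (SOME h. h \<in> K \<and> T h (T (v A) x) \<in> U)" for A
  have h: "h A \<in> K" "T (h A) (T (v A) x) \<in> U" if "A \<subseteq> I" for A
    using someI_ex[of "\<lambda>h. h \<in> K \<and> T h (T (v A) x) \<in> U"] K(3)[OF TX[OF vG[OF that] x]]
    unfolding h_def by blast+
  obtain ix where ix: "bij_betw ix K {..<card K}"
    using ex_bij_betw_finite_nat[OF K(1)] by (auto simp: lessThan_atLeast0)
  have "(\<lambda>A. ix (h A)) ` Pow I \<subseteq> {..<card K}"
    using h ix by (auto simp: bij_betw_def)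
  from cube_near_antipodal[OF I(1) this]
  obtain A B where AB: "A \<subseteq> I" "B \<subseteq> I" "ix (h A) = ix (h B)"
    "card I \<le> card ((A - B) \<union> (B - A)) + card K" by blast
  define E where "E = (A - B) \<union> (B - A)"
  have hAB: "h A = h B" using AB h ix by (auto simp: bij_betw_def inj_on_def)
  have EI: "E \<subseteq> I" using AB by (auto simp: E_def)
  have "{i \<in> I. v E i \<noteq> 1} = I - E" by (auto simp: v_def)
  then have "card {i \<in> I. v E i \<noteq> 1} \<le> k"
    using AB(4) I(1,2) EI card_Diff_subset[OF finite_subset[OF EI I(1)] EI] by (simp add: E_def)
  then have "v E \<in> near_ones 2 I k"
    using EI by (auto simp: near_ones_def v_def)
  then have "v E \<in> R" using I(4) by blast
  moreover have "v E \<noteq> \<one>\<^bsub>?G\<^esub>"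
  proof -
    have "card E > 0" using AB(4) I(2,3) by (simp add: E_def)
    then obtain i where "i \<in> E" by (auto simp: card_gt_0_iff)
    then have "v E i \<noteq> 0" by (simp add: v_def)
    then show ?thesis by auto
  qed
  moreover have "T (v E) (T (h B) (T (v B) x)) = T (h A) (T (v A) x)"
  proof -
    have hG: "h B \<in> carrier ?G" using h(1)[OF AB(2)] K(2) by blast
    note mem = vG[OF EI] vG[OF AB(2)] hG x TX
    have comm: "v E \<otimes>\<^bsub>?G\<^esub> h B = h B \<otimes>\<^bsub>?G\<^esub> v E" by (simp add: add.commute)
    have sum: "v E \<otimes>\<^bsub>?G\<^esub> v B = v A" by (auto simp: v_def E_def fun_eq_iff)
    have "T (v E) (T (h B) (T (v B) x)) = T (h B \<otimes>\<^bsub>?G\<^esub> v E) (T (v B) x)"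
      using T.composition_rule[of "T (v B) x" "v E" "h B"] mem comm by metis
    also have "\<dots> = T (h B) (T (v E \<otimes>\<^bsub>?G\<^esub> v B) x)"
      using T.composition_rule mem by metis
    finally show ?thesis unfolding sum hAB .
  qed
  then have "T (h A) (T (v A) x) \<in> U \<inter> T (v E) ` U"
    using h(2)[OF AB(1)] h(2)[OF AB(2)] by (metis IntI imageI)
  ultimately show "\<exists>g\<in>R. g \<noteq> \<one>\<^bsub>?G\<^esub> \<and> U \<inter> T g ` U \<noteq> {}" by blast
qed

section \<open>Density in the Bohr topology\<close>

lemma character_Fp_omega:
  assumes "\<xi> \<in> hom (Fp_omega p) circle_group" "p > 0" "x \<in> carrier (Fp_omega p)"
  shows "\<xi> (\<lambda>i. (int m * x i) mod int p) = \<xi> x ^ m" and "\<xi> x ^ p = 1"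
proof -
  interpret group "Fp_omega p" by (rule group_Fp_omega)
  have mul: "\<xi> (\<lambda>i. (y i + z i) mod int p) = \<xi> y * \<xi> z"
    if "y \<in> carrier (Fp_omega p)" "z \<in> carrier (Fp_omega p)" for y z
    using hom_mult[OF assms(1) that] by (simp add: circle_group_def)
  have nz: "\<xi> y \<noteq> 0" if "y \<in> carrier (Fp_omega p)" for y
    using hom_in_carrier[OF assms(1) that] by (auto simp: circle_group_def)
  have "(\<lambda>i. 0) \<in> carrier (Fp_omega p)" using one_closed by simp
  then have zero: "\<xi> (\<lambda>i. 0) = 1"
    using mul[of "\<lambda>i. 0" "\<lambda>i. 0"] nz[of "\<lambda>i. 0"] by simp
  have mem: "(\<lambda>i. (int m * x i) mod int p) \<in> carrier (Fp_omega p)" for m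
    using assms(2,3) by (auto simp: carrier_Fp_omega elim!: rev_finite_subset)
  have pw: "\<xi> (\<lambda>i. (int m * x i) mod int p) = \<xi> x ^ m" for m
  proof (induction m)
    case (Suc m)
    have "(\<lambda>i. (int (Suc m) * x i) mod int p) = (\<lambda>i. ((int m * x i) mod int p + x i) mod int p)"
      by (auto simp: algebra_simps mod_simps)
    then show ?case using mul[OF mem[of m] assms(3)] Suc by simp
  qed (simp add: zero)
  show "\<xi> (\<lambda>i. (int m * x i) mod int p) = \<xi> x ^ m" by (rule pw)
  show "\<xi> x ^ p = 1" using pw[of p] by (simp add: zero)
qed

text \<open>Take an element \<open>e\<close> of all the kernels with as few coordinates different from 1 as possible, and
  let \<open>Z\<close> be the set of these coordinates. The characters take \<open>p\<^sup>k\<close> joint values at most, so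
  if \<open>Z\<close> had more than \<open>k\<close> elements, two vectors supported on \<open>Z\<close> would have the same value. Some
  multiple of their difference, added to \<open>e\<close>, makes one coordinate in \<open>Z\<close> equal to 1 and touches
  nothing outside \<open>Z\<close>. Dividing by the coordinate of the difference is where \<open>p\<close> has to be prime.\<close>

lemma near_ones_in_kernel:
  assumes p: "Factorial_Ring.prime p" and I: "finite I"
    and hom: "\<And>j. j \<in> {1..k} \<Longrightarrow> \<xi> j \<in> hom (Fp_omega p) circle_group"
  shows "\<exists>e\<in>near_ones p I k. \<forall>j\<in>{1..k}. \<xi> j e = 1"
proof -
  have p0: "p > 0" "p > 1" using p prime_gt_0_nat prime_gt_1_nat by blast+
  define Q where "Q e \<longleftrightarrow> e \<in> near_ones p I (card I) \<and> (\<forall>j\<in>{1..k}. \<xi> j e = 1)" for e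
  have carr: "near_ones p I m \<subseteq> carrier (Fp_omega p)" for m
    by (rule near_ones_carrier[OF p0(1) I])
  have "Q (\<lambda>i. 0)"
  proof -
    have z: "(\<lambda>i. 0) \<in> near_ones p I (card I)" using p0 by (simp add: near_ones_def card_mono I)
    moreover have "\<xi> j (\<lambda>i. 0) = 1" if "j \<in> {1..k}" for j
      using character_Fp_omega(1)[OF hom[OF that] p0(1), of "\<lambda>i. 0" 0] z carr by auto
    ultimately show ?thesis by (simp add: Q_def)
  qed
  then obtain e where e: "Q e" and least: "\<And>e'. Q e' \<Longrightarrow> card {i \<in> I. e i \<noteq> 1} \<le> card {i \<in> I. e' i \<noteq> 1}"
    using ex_has_least_nat[of Q _ "\<lambda>e. card {i \<in> I. e i \<noteq> 1}"] by blast
  define Z where "Z = {i \<in> I. e i \<noteq> 1}"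
  have ZI: "Z \<subseteq> I" "finite Z" using I by (auto simp: Z_def)
  have "card Z \<le> k"
  proof (rule ccontr)
    assume many: "\<not> card Z \<le> k"
    define W where "W = PiE_dflt Z 0 (\<lambda>_. {0..<int p})"
    define R where "R = PiE {1..k} (\<lambda>_. {z::complex. z ^ p = 1})"
    have finroots: "finite {z::complex. z ^ p = 1}"
      using card_roots_unity_eq[OF p0(1)] p0(1) by (metis card_ge_0_finite)
    have cardW: "card W = p ^ card Z" unfolding W_def using ZI by (subst card_PiE_dflt) auto
    have cardR: "card R = p ^ k"
      unfolding R_def by (simp add: card_PiE card_roots_unity_eq[OF p0(1)])
    have WC: "w \<in> carrier (Fp_omega p)" if "w \<in> W" for w
    proof -
      have "{i. w i \<noteq> 0} \<subseteq> Z" using that by (auto simp: W_def PiE_dflt_def)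
      moreover have "w i \<in> {0..<int p}" for i
        using that p0 by (cases "i \<in> Z") (auto simp: W_def PiE_dflt_def)
      ultimately show ?thesis using ZI(2) by (auto simp: carrier_Fp_omega[OF p0(1)] intro: finite_subset)
    qed
    define val where "val w = (\<lambda>j\<in>{1..k}. \<xi> j w)" for w
    have "val ` W \<subseteq> R"
      using character_Fp_omega(2)[OF hom p0(1)] WC by (auto simp: val_def R_def)
    moreover have "finite R" using finroots by (auto simp: R_def intro: finite_PiE)
    ultimately have "card (val ` W) \<le> p ^ k" using card_mono cardR by metis
    also have "\<dots> < card W" unfolding cardW using many p0(2) by (intro power_strict_increasing) auto
    finally have "\<not> inj_on val W" by (rule pigeonhole)
    then obtain v w where vw: "v \<in> W" "w \<in> W" "val v = val w" "v \<noteq> w"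
      by (auto simp: inj_on_def)
    \<comment> \<open>the difference \<open>v - w\<close>, written without subtraction so that the characters can be evaluated\<close>
    define d where "d = (\<lambda>i. (v i + (int (p - 1) * w i) mod int p) mod int p)"
    have mem: "(\<lambda>i. (int m * x i) mod int p) \<in> carrier (Fp_omega p)"
      if "x \<in> carrier (Fp_omega p)" for m x
      using that p0(1) by (auto simp: carrier_Fp_omega elim!: rev_finite_subset)
    interpret group "Fp_omega p" by (rule group_Fp_omega)
    have add: "(\<lambda>i. (x i + y i) mod int p) \<in> carrier (Fp_omega p)"
      if "x \<in> carrier (Fp_omega p)" "y \<in> carrier (Fp_omega p)" for x y
      using m_closed[OF that] by simp
    have hadd: "\<xi> j (\<lambda>i. (x i + y i) mod int p) = \<xi> j x * \<xi> j y"
      if "j \<in> {1..k}" "x \<in> carrier (Fp_omega p)" "y \<in> carrier (Fp_omega p)" for x y j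
      using hom_mult[OF hom that(2,3)] that(1) by (simp add: circle_group_def)
    have dC: "d \<in> carrier (Fp_omega p)"
      unfolding d_def by (intro add mem WC vw)
    have d1: "\<xi> j d = 1" if j: "j \<in> {1..k}" for j
    proof -
      have "\<xi> j d = \<xi> j v * \<xi> j w ^ (p - 1)"
        unfolding d_def using hadd[OF j WC[OF vw(1)] mem[OF WC[OF vw(2)]]]
          character_Fp_omega(1)[OF hom[OF j] p0(1) WC[OF vw(2)]] by simp
      also have "\<xi> j v = \<xi> j w" using fun_cong[OF vw(3), of j] j by (simp add: val_def)
      also have "\<xi> j w * \<xi> j w ^ (p - 1) = \<xi> j w ^ p" using p0(1) by (simp flip: power_Suc)
      also have "\<dots> = 1" by (rule character_Fp_omega(2)[OF hom[OF j] p0(1) WC[OF vw(2)]])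
      finally show ?thesis .
    qed
    obtain z where z: "v z \<noteq> w z" using vw(4) by auto
    then have zZ: "z \<in> Z" using vw by (auto simp: W_def PiE_dflt_def)
    have d_diff: "d i = (v i - w i) mod int p" for i
    proof -
      have "v i + int (p - 1) * w i = v i - w i + int p * w i"
        using p0 by (simp add: of_nat_diff algebra_simps)
      then have "(v i + int (p - 1) * w i) mod int p = (v i - w i) mod int p"
        by (simp only: mod_mult_self2)
      then show ?thesis by (simp only: d_def mod_add_right_eq)
    qed
    have vr: "v z \<in> {0..<int p}" "w z \<in> {0..<int p}"
      using vw zZ by (auto simp: W_def PiE_dflt_def)
    have "\<not> int p dvd d z"
    proof
      assume "int p dvd d z"
      then have "(v z - w z) mod int p = 0" unfolding d_diff by (simp add: dvd_eq_mod_eq_0)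
      then have "v z mod int p = w z mod int p" by (simp add: mod_eq_dvd_iff mod_0_imp_dvd)
      then show False using z vr by simp
    qed
    then have "coprime (d z) (int p)"
      using p by (metis coprime_commute prime_imp_coprime prime_nat_int_transfer)
    then obtain m0 where m0: "[d z * m0 = 1 - e z] (mod int p)"
      by (metis cong_scalar_right cong_solve_coprime_int mult.assoc mult_1)
    define m where "m = nat (m0 mod int p)"
    have m: "(e z + int m * d z) mod int p = 1"
    proof -
      have "(e z + int m * d z) mod int p = (e z + m0 * d z) mod int p"
      proof -
        have "int m = m0 mod int p" using p0 by (simp add: m_def)
        then show ?thesis by (metis mod_add_right_eq mod_mult_left_eq)
      qed
      also have "\<dots> = (e z + (1 - e z)) mod int p"
        using m0 unfolding cong_def by (metis mod_add_right_eq mult.commute)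
      finally show ?thesis using p0 by simp
    qed
    define e' where "e' = (\<lambda>i. (e i + (int m * d i) mod int p) mod int p)"
    have eC: "e \<in> carrier (Fp_omega p)" using e carr by (auto simp: Q_def)
    have dZ: "d i = 0" if "i \<notin> Z" for i
      using that vw unfolding d_diff by (auto simp: W_def PiE_dflt_def)
    have range: "e i \<in> {0..<int p}" for i using e by (auto simp: Q_def near_ones_def)
    have e'Z: "e' i = e i" if "i \<notin> Z" for i
      using dZ[OF that] range[of i] by (simp add: e'_def)
    have "\<xi> j e' = 1" if j: "j \<in> {1..k}" for j
      unfolding e'_def using hadd[OF j eC mem[OF dC]] e j d1[OF j]
        character_Fp_omega(1)[OF hom[OF j] p0(1) dC] by (simp add: Q_def)
    moreover have "e' \<in> near_ones p I (card I)"
    proof -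
      have "e' i \<in> {0..<int p}" for i using p0 by (simp add: e'_def)
      moreover have "e' i = 0" if "i \<notin> I" for i
        using e'Z[of i] that ZI e by (auto simp: Q_def near_ones_def)
      ultimately show ?thesis by (simp add: near_ones_def card_mono I)
    qed
    ultimately have "Q e'" by (simp add: Q_def)
    have "e' z = 1" using m by (simp add: e'_def mod_simps)
    then have "{i \<in> I. e' i \<noteq> 1} \<subseteq> Z - {z}" using e'Z by (force simp: Z_def)
    then have "card {i \<in> I. e' i \<noteq> 1} \<le> card (Z - {z})" using ZI by (intro card_mono) auto
    also have "\<dots> < card Z" using zZ ZI by (intro card_Diff1_less)
    finally show False using least[OF \<open>Q e'\<close>] by (simp add: Z_def)
  qed
  then show ?thesis using e by (auto simp: Q_def near_ones_def Z_def)
qed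

lemma bohr_dense_near_ones:
  assumes p: "Factorial_Ring.prime p" and S: "S \<subseteq> carrier (Fp_omega p)"
    and near: "\<And>t k. t \<in> carrier (Fp_omega p) \<Longrightarrow>
      \<exists>I m. finite I \<and> k \<le> m \<and> (\<forall>e\<in>near_ones p I m. t \<otimes>\<^bsub>Fp_omega p\<^esub> e \<in> S)"
  shows "bohr_dense (Fp_omega p) S"
  unfolding bohr_dense_iff[OF group_Fp_omega S]
proof (intro ballI allI impI)
  fix t B assume t: "t \<in> carrier (Fp_omega p)" and "bohr_set (Fp_omega p) B"
  then obtain \<epsilon> k \<xi> where B: "\<epsilon> > 0"
      "\<And>j. j \<in> {1..k::nat} \<Longrightarrow> \<xi> j \<in> hom (Fp_omega p) circle_group"
      "B = {g \<in> carrier (Fp_omega p). \<forall>j\<in>{1..k}. cmod (\<xi> j g - 1) < \<epsilon>}"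
    unfolding bohr_set_def by blast
  obtain I m where I: "finite I" "k \<le> m" "\<forall>e\<in>near_ones p I m. t \<otimes>\<^bsub>Fp_omega p\<^esub> e \<in> S"
    using near[OF t] by blast
  obtain e where e: "e \<in> near_ones p I k" "\<forall>j\<in>{1..k}. \<xi> j e = 1"
    using near_ones_in_kernel[OF p I(1), of k \<xi>] B(2) by blast
  have "e \<in> B"
    using e near_ones_carrier[OF prime_gt_0_nat[OF p] I(1)] B(1,3) by auto
  moreover have "e \<in> near_ones p I m" using e(1) I(2) by (auto simp: near_ones_def)
  ultimately have "t \<otimes>\<^bsub>Fp_omega p\<^esub> e \<in> S \<inter> (t <#\<^bsub>Fp_omega p\<^esub> B)"
    using I(3) unfolding l_coset_def by blast
  then show "S \<inter> (t <#\<^bsub>Fp_omega p\<^esub> B) \<noteq> {}" by blast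
qed


section \<open>Failure of measurable recurrence on an arbitrary point set\<close>

lemma group_actionI:
  assumes G: "group G"
    and closed: "\<And>g x. g \<in> carrier G \<Longrightarrow> x \<in> E \<Longrightarrow> T g x \<in> E"
    and one: "\<And>x. x \<in> E \<Longrightarrow> T \<one>\<^bsub>G\<^esub> x = x"
    and mult: "\<And>g h x. g \<in> carrier G \<Longrightarrow> h \<in> carrier G \<Longrightarrow> x \<in> E \<Longrightarrow>
      T (g \<otimes>\<^bsub>G\<^esub> h) x = T g (T h x)"
    and ext: "\<And>g. g \<in> carrier G \<Longrightarrow> T g \<in> extensional E"
  shows "group_action G E T"
proof -
  interpret group G by (rule G)
  have bij: "T g \<in> Bij E" if g: "g \<in> carrier G" for g
  proof -
    have "bij_betw (T g) E E"
      by (rule bij_betw_byWitness[where f' = "T (inv\<^bsub>G\<^esub> g)"])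
        (use g mult[of "inv\<^bsub>G\<^esub> g" g] mult[of g "inv\<^bsub>G\<^esub> g"] one closed in auto)
    then show ?thesis using ext[OF g] by (simp add: Bij_def)
  qed
  show ?thesis
  proof (intro group_action.intro group_hom.intro group_hom_axioms.intro homI)
    fix g h assume gh: "g \<in> carrier G" "h \<in> carrier G"
    have "T (g \<otimes>\<^bsub>G\<^esub> h) = compose E (T g) (T h)"
    proof
      fix x show "T (g \<otimes>\<^bsub>G\<^esub> h) x = compose E (T g) (T h) x"
        using mult[OF gh] ext[of "g \<otimes>\<^bsub>G\<^esub> h"] gh
        by (cases "x \<in> E") (auto simp: compose_def extensional_def)
    qed
    then show "T (g \<otimes>\<^bsub>G\<^esub> h) = T g \<otimes>\<^bsub>BijGroup E\<^esub> T h"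
      using bij gh by (simp add: BijGroup_def)
  qed (use bij in \<open>auto simp: BijGroup_def group_BijGroup[unfolded BijGroup_def] G\<close>)
qed

text \<open>The definition of measurable recurrence quantifies over probability spaces of real numbers; a system
  on any set that injects into the reals can be transported there.\<close>

lemma not_measurable_recurrenceI:
  fixes M :: "'x measure" and f :: "'x \<Rightarrow> real"
  assumes f: "inj f" and M: "prob_space M" and T: "measure_preserving_action G M T"
    and D: "D \<in> sets M" "measure M D > 0" and S: "S \<subseteq> carrier G"
    and null: "\<And>g. g \<in> S \<Longrightarrow> measure M (D \<inter> T g ` D) = 0"
  shows "\<not> measurable_recurrence G S"
proof
  assume rec: "measurable_recurrence G S"
  interpret prob_space M by (rule M)
  interpret T: group_action G "space M" T
    using T by (simp add: measure_preserving_action_def)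
  have G: "group G" using T.group_hom by (simp add: group_hom_def)
  define N where "N = embed_measure M f"
  have spN: "space N = f ` space M" by (simp add: N_def space_embed_measure)
  have fm: "f \<in> measurable M N" unfolding N_def by (rule measurable_embed_measure2[OF f])
  have Nd: "N = distr M N f" unfolding N_def by (rule embed_measure_eq_distr[OF f])
  have N: "prob_space N" using prob_space_distr[OF fm] Nd by simp
  define T' where "T' g = (\<lambda>y\<in>space N. f (T g (inv_into UNIV f y)))" for g
  have TX: "T g x \<in> space M" if "g \<in> carrier G" "x \<in> space M" for g x
    using that T.element_image by blast
  have T'f: "T' g (f x) = f (T g x)" if "x \<in> space M" for g x
    using that f by (simp add: T'_def spN)
  have act: "group_action G (space N) T'"
  proof (rule group_actionI[OF G])
    show "T' \<one>\<^bsub>G\<^esub> y = y" if "y \<in> space N" for y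
      using that T.id_eq_one[symmetric] by (auto simp: spN T'f)
    show "T' (g \<otimes>\<^bsub>G\<^esub> h) y = T' g (T' h y)"
      if "g \<in> carrier G" "h \<in> carrier G" "y \<in> space N" for g h y
      using that TX by (auto simp: spN T'f T.composition_rule)
  qed (auto simp: spN T'f TX, simp add: T'_def spN)
  have Tm: "T g \<in> measurable M M" "distr M M (T g) = M" if "g \<in> carrier G" for g
    using T that by (auto simp: measure_preserving_action_def)
  have T'm: "T' g \<in> measurable N N" if g: "g \<in> carrier G" for g
    unfolding N_def
  proof (rule measurable_embed_measure1)
    have "(\<lambda>x. f (T g x)) \<in> measurable M N" using fm Tm(1)[OF g] by (rule measurable_compose_rev)
    then show "(\<lambda>x. T' g (f x)) \<in> measurable M (embed_measure M f)"
      unfolding N_def by (subst measurable_cong[where g = "\<lambda>x. f (T g x)"]) (auto simp: T'f)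
  qed
  have "distr N N (T' g) = N" if g: "g \<in> carrier G" for g
  proof -
    have "distr N N (T' g) = distr M N (T' g \<circ> f)"
      by (subst Nd) (rule distr_distr[OF T'm[OF g] fm])
    also have "\<dots> = distr M N (f \<circ> T g)"
      by (rule distr_cong) (auto simp: T'f)
    also have "\<dots> = distr (distr M M (T g)) N f"
      by (rule distr_distr[OF fm Tm(1)[OF g], symmetric])
    finally show ?thesis using Tm(2)[OF g] Nd by simp
  qed
  then have mpa: "measure_preserving_action G N T'"
    using act T'm by (simp add: measure_preserving_action_def)
  have meas: "measure N (f ` A) = measure M A" if "A \<in> sets M" for A
  proof -
    have "f ` A \<in> sets N" unfolding N_def by (rule in_sets_embed_measure[OF that])
    moreover have "f -` f ` A \<inter> space M = A"
      using f sets.sets_into_space[OF that] by (auto simp: inj_def)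
    ultimately show ?thesis using emeasure_embed_measure[OF f, of "f ` A" M] by (simp add: N_def measure_def)
  qed
  have "f ` D \<in> sets N" "measure N (f ` D) > 0"
    using D meas by (auto simp: N_def in_sets_embed_measure)
  then obtain g where g: "g \<in> S" "measure N (f ` D \<inter> T' g ` f ` D) > 0"
    using rec N mpa unfolding measurable_recurrence_def by blast
  have gG: "g \<in> carrier G" using g S by blast
  have Dsp: "D \<subseteq> space M" using D sets.sets_into_space by blast
  have TD: "T g ` D = T (inv\<^bsub>G\<^esub> g) -` D \<inter> space M"
  proof (intro equalityI subsetI)
    fix y assume "y \<in> T g ` D"
    then obtain x where "x \<in> D" "y = T g x" by blast
    then show "y \<in> T (inv\<^bsub>G\<^esub> g) -` D \<inter> space M"
      using T.orbit_sym_aux[OF gG, of x] Dsp TX[OF gG] by auto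
  next
    fix y assume "y \<in> T (inv\<^bsub>G\<^esub> g) -` D \<inter> space M"
    moreover from this have "T g (T (inv\<^bsub>G\<^esub> g) y) = y"
      using T.orbit_sym_aux[of "inv\<^bsub>G\<^esub> g" y] gG G by (auto simp: group.inv_inv)
    ultimately show "y \<in> T g ` D" by (metis IntD1 image_eqI vimageE)
  qed
  have "T g ` D \<in> sets M"
    unfolding TD by (rule measurable_sets[OF Tm(1)[OF group.inv_closed[OF G gG]] D(1)])
  moreover have "T' g ` f ` D = f ` T g ` D"
    unfolding image_image by (rule image_cong[OF refl]) (use T'f Dsp in blast)
  ultimately show False
    using g(2) null[OF g(1)] meas[of "D \<inter> T g ` D"] D(1)
    by (metis image_Int[OF f] less_irrefl sets.Int)
qed

lemma int_sequences_inj_real: "\<exists>f :: (nat \<Rightarrow> int) \<Rightarrow> real. inj f"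
proof -
  obtain h :: "nat set \<Rightarrow> real" where h: "inj h"
    using nat_sets_eqpoll_reals unfolding eqpoll_def bij_betw_def by blast
  have "inj (\<lambda>x :: nat \<Rightarrow> int. range (\<lambda>i. to_nat (i, x i)))"
  proof (rule injI, rule ext)
    fix x y :: "nat \<Rightarrow> int" and i
    assume "range (\<lambda>i. to_nat (i, x i)) = range (\<lambda>i. to_nat (i, y i))"
    then have "to_nat (i, x i) \<in> range (\<lambda>i. to_nat (i, y i))" by blast
    then show "x i = y i" by auto
  qed
  from inj_compose[OF h this] show ?thesis by blast
qed

section \<open>Digit sequences\<close>

definition digits :: "nat \<Rightarrow> (nat \<Rightarrow> int) set" where
  "digits p = {x. \<forall>i. x i \<in> {0..<int p}}"

definition digit_measure :: "nat \<Rightarrow> (nat \<Rightarrow> int) measure" where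
  "digit_measure p = PiM UNIV (\<lambda>_. uniform_count_measure {0..<int p})"

lemma space_digit_measure [simp]: "space (digit_measure p) = digits p"
  by (auto simp: digit_measure_def digits_def space_PiM space_uniform_count_measure PiE_iff)

lemma prob_space_digit:
  "p > 0 \<Longrightarrow> prob_space (uniform_count_measure {0..<int p})"
  by (rule prob_space_uniform_count_measure) auto

lemma prob_space_digit_measure: "p > 0 \<Longrightarrow> prob_space (digit_measure p)"
  unfolding digit_measure_def by (intro prob_space_PiM prob_space_digit)

definition cylinder :: "nat \<Rightarrow> nat \<Rightarrow> (nat \<Rightarrow> int) \<Rightarrow> (nat \<Rightarrow> int) set" where
  "cylinder p n w = {x \<in> digits p. \<forall>i<n. x i = w i}"

lemma cylinder_eq_emb:
  "cylinder p n w = prod_emb UNIV (\<lambda>_. uniform_count_measure {0..<int p}) {..<n} (PiE {..<n} (\<lambda>i. {w i}))"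
  by (auto simp: cylinder_def digits_def prod_emb_def space_uniform_count_measure PiE_iff)

lemma cylinder:
  assumes "p > 0" "w \<in> digits p"
  shows sets_cylinder: "cylinder p n w \<in> sets (digit_measure p)"
    and emeasure_cylinder: "emeasure (digit_measure p) (cylinder p n w) = (1 / ennreal p) ^ n"
proof -
  have w: "w i \<in> {0..<int p}" for i using assms(2) by (auto simp: digits_def)
  show "cylinder p n w \<in> sets (digit_measure p)"
    unfolding cylinder_eq_emb digit_measure_def
    by (rule sets_PiM_I) (use w in \<open>auto simp: sets_uniform_count_measure\<close>)
  have "emeasure (digit_measure p) (cylinder p n w) =
      (\<Prod>i\<in>{..<n}. emeasure (uniform_count_measure {0..<int p}) {w i})"
    unfolding cylinder_eq_emb digit_measure_def
    by (rule emeasure_PiM_emb) (use w assms in \<open>auto simp: sets_uniform_count_measure prob_space_digit\<close>)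
  also have "\<dots> = (1 / ennreal p) ^ n"
  proof -
    have "emeasure (uniform_count_measure {0..<int p}) {w i} = 1 / ennreal p" for i
      using w[of i] by (subst emeasure_uniform_count_measure)
        (auto simp: divide_ennreal assms(1) simp flip: ennreal_1)
    then show ?thesis by simp
  qed
  finally show "emeasure (digit_measure p) (cylinder p n w) = (1 / ennreal p) ^ n" .
qed

text \<open>Words of length \<open>n\<close>, continued by zeros, as representatives of the cylinders of length \<open>n\<close>.\<close>

definition words :: "nat \<Rightarrow> nat \<Rightarrow> (nat \<Rightarrow> int) set" where
  "words p n = PiE_dflt {..<n} 0 (\<lambda>_. {0..<int p})"

lemma words:
  assumes "p > 0"
  shows finite_words: "finite (words p n)" and words_digits: "words p n \<subseteq> digits p"
    and words_cover: "x \<in> digits p \<Longrightarrow> \<exists>w\<in>words p n. x \<in> cylinder p n w"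
    and words_unique: "w \<in> words p n \<Longrightarrow> v \<in> words p n \<Longrightarrow> \<forall>i<n. w i = v i \<Longrightarrow> w = v"
proof -
  show "finite (words p n)" unfolding words_def by (rule finite_PiE_dflt) auto
  show "words p n \<subseteq> digits p"
  proof
    fix w assume w: "w \<in> words p n"
    have "w i \<in> {0..<int p}" for i
      using w assms by (cases "i < n") (auto simp: words_def PiE_dflt_def)
    then show "w \<in> digits p" by (simp add: digits_def)
  qed
  show "\<exists>w\<in>words p n. x \<in> cylinder p n w" if "x \<in> digits p"
    by (rule bexI[of _ "\<lambda>i. if i < n then x i else 0"])
      (use that in \<open>auto simp: words_def PiE_dflt_def cylinder_def digits_def\<close>)
  show "w = v" if "w \<in> words p n" "v \<in> words p n" "\<forall>i<n. w i = v i"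
  proof
    fix i show "w i = v i"
      using that by (cases "i < n") (auto simp: words_def PiE_dflt_def)
  qed
qed

text \<open>Membership is decided by the first \<open>n\<close> digits.\<close>

definition prefix_set :: "nat \<Rightarrow> nat \<Rightarrow> (nat \<Rightarrow> int) set \<Rightarrow> bool" where
  "prefix_set p n B \<longleftrightarrow> B \<subseteq> digits p \<and> (\<forall>x\<in>B. cylinder p n x \<subseteq> B)"

lemma prefix_set_decompose:
  assumes "p > 0" "prefix_set p n B"
  shows "B = (\<Union>w\<in>words p n \<inter> B. cylinder p n w)"
proof (intro equalityI subsetI)
  fix x assume x: "x \<in> B"
  then have "x \<in> digits p" using assms(2) by (auto simp: prefix_set_def)
  then obtain w where w: "w \<in> words p n" "x \<in> cylinder p n w"
    using words_cover[OF assms(1)] by blast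
  then have "w \<in> cylinder p n x"
    using words_digits[OF assms(1)] by (auto simp: cylinder_def)
  then show "x \<in> (\<Union>w\<in>words p n \<inter> B. cylinder p n w)"
    using x w assms(2) by (auto simp: prefix_set_def)
qed (use assms(2) in \<open>auto simp: prefix_set_def\<close>)

lemma sets_prefix_set:
  assumes "p > 0" "prefix_set p n B"
  shows "B \<in> sets (digit_measure p)"
  by (subst prefix_set_decompose[OF assms], rule sets.finite_UN)
    (use finite_words[OF assms(1)] subsetD[OF words_digits[OF assms(1)]]
      in \<open>auto intro: sets_cylinder[OF assms(1)]\<close>)

lemma emeasure_prefix_set:
  assumes "p > 0" "prefix_set p n B"
  shows "emeasure (digit_measure p) B = of_nat (card (words p n \<inter> B)) * (1 / ennreal p) ^ n"
proof -
  have "emeasure (digit_measure p) B = emeasure (digit_measure p) (\<Union>w\<in>words p n \<inter> B. cylinder p n w)"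
    using prefix_set_decompose[OF assms] by simp
  also have "\<dots> = (\<Sum>w\<in>words p n \<inter> B. emeasure (digit_measure p) (cylinder p n w))"
  proof (rule sum_emeasure[symmetric])
    show "disjoint_family_on (cylinder p n) (words p n \<inter> B)"
      using words_unique[OF assms(1), of _ n] by (fastforce simp: disjoint_family_on_def cylinder_def)
  qed (use finite_words[OF assms(1)] subsetD[OF words_digits[OF assms(1)]]
      in \<open>auto intro: sets_cylinder[OF assms(1)]\<close>)
  also have "\<dots> = (\<Sum>w\<in>words p n \<inter> B. (1 / ennreal p) ^ n)"
    using words_digits[OF assms(1)] by (intro sum.cong refl emeasure_cylinder[OF assms(1)]) auto
  finally show ?thesis by simp
qed

text \<open>Such a map permutes the cylinders of each length \<open>n \<ge> N\<close>, and all of them have measure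
  \<open>1 / p\<^sup>n\<close>.\<close>

lemma prefix_respecting_measure_preserving:
  assumes p: "p > 0" and bij: "bij_betw F (digits p) (digits p)"
    and respects: "\<And>n x y. N \<le> n \<Longrightarrow> x \<in> digits p \<Longrightarrow> y \<in> digits p \<Longrightarrow>
      (\<forall>i<n. F x i = F y i) \<longleftrightarrow> (\<forall>i<n. x i = y i)"
  shows "F \<in> measurable (digit_measure p) (digit_measure p)"
    and "distr (digit_measure p) (digit_measure p) F = digit_measure p"
proof -
  let ?M = "digit_measure p"
  have FD: "F x \<in> digits p" if "x \<in> digits p" for x
    using bij that by (auto simp: bij_betw_def)
  have pre: "prefix_set p n (F -` B \<inter> digits p)" if "N \<le> n" "prefix_set p n B" for n B
    unfolding prefix_set_def
  proof (intro conjI ballI subsetI)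
    fix x y assume x: "x \<in> F -` B \<inter> digits p" and y: "y \<in> cylinder p n x"
    then have "F y \<in> cylinder p n (F x)"
      using respects[OF that(1), of y x] FD by (auto simp: cylinder_def)
    then show "y \<in> F -` B \<inter> digits p"
      using that(2) x y by (auto simp: prefix_set_def cylinder_def)
  qed auto
  show meas: "F \<in> measurable ?M ?M"
    unfolding digit_measure_def
  proof (rule measurable_PiM_single)
    show "F \<in> space (Pi\<^sub>M UNIV (\<lambda>_. uniform_count_measure {0..<int p})) \<rightarrow>
        (UNIV \<rightarrow>\<^sub>E space (uniform_count_measure {0..<int p}))"
      using FD by (auto simp: digits_def space_PiM space_uniform_count_measure PiE_iff)
    fix A i
    define n where "n = max N (Suc i)"
    have "prefix_set p n {x \<in> digits p. x i \<in> A}"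
      by (auto simp: prefix_set_def cylinder_def n_def)
    from sets_prefix_set[OF p pre[OF _ this]]
    have "F -` {x \<in> digits p. x i \<in> A} \<inter> digits p \<in> sets ?M" by (simp add: n_def)
    moreover have "F -` {x \<in> digits p. x i \<in> A} \<inter> digits p = {x \<in> digits p. F x i \<in> A}"
      using FD by auto
    ultimately show "{x \<in> space (Pi\<^sub>M UNIV (\<lambda>_. uniform_count_measure {0..<int p})). F x i \<in> A}
        \<in> sets (Pi\<^sub>M UNIV (\<lambda>_. uniform_count_measure {0..<int p}))"
      using space_digit_measure[of p] by (simp add: digit_measure_def)
  qed
  have eq: "emeasure ?M (F -` B \<inter> digits p) = emeasure ?M B"
    if B: "prefix_set p n B" and n: "N \<le> n" for n B
  proof -
    let ?P = "words p n"
    have "\<exists>v. v \<in> ?P \<and> F w \<in> cylinder p n v" if "w \<in> ?P" for w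
      using words_cover[OF p FD] words_digits[OF p] that by blast
    then obtain \<phi> where \<phi>: "\<phi> w \<in> ?P" "F w \<in> cylinder p n (\<phi> w)" if "w \<in> ?P" for w by metis
    have "inj_on \<phi> ?P"
    proof (rule inj_onI)
      fix w v assume wv: "w \<in> ?P" "v \<in> ?P" "\<phi> w = \<phi> v"
      then have "\<forall>i<n. F w i = F v i" using \<phi>(2)[of w] \<phi>(2)[of v] by (simp add: cylinder_def)
      then have "\<forall>i<n. w i = v i" using respects[OF n] wv words_digits[OF p] by blast
      then show "w = v" using words_unique[OF p] wv by blast
    qed
    note inj = this
    have surj: "\<phi> ` ?P = ?P"
      using \<phi>(1) by (intro endo_inj_surj finite_words[OF p] inj) auto
    have mem: "w \<in> F -` B \<inter> digits p \<longleftrightarrow> \<phi> w \<in> B" if w: "w \<in> ?P" for w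
    proof -
      have "\<phi> w \<in> cylinder p n (F w)" "w \<in> digits p"
        using \<phi>[OF w] words_digits[OF p] w by (auto simp: cylinder_def)
      then show ?thesis using \<phi>(2)[OF w] B by (auto simp: prefix_set_def)
    qed
    have "?P \<inter> (F -` B \<inter> digits p) = {w \<in> ?P. \<phi> w \<in> B}" using mem by blast
    moreover have "card {w \<in> ?P. \<phi> w \<in> B} = card (\<phi> ` {w \<in> ?P. \<phi> w \<in> B})"
      by (rule card_image[symmetric]) (rule inj_on_subset[OF inj], blast)
    moreover have "\<phi> ` {w \<in> ?P. \<phi> w \<in> B} = \<phi> ` ?P \<inter> B" by blast
    ultimately have "card (?P \<inter> (F -` B \<inter> digits p)) = card (?P \<inter> B)" using surj by simp
    then show ?thesis by (simp add: emeasure_prefix_set[OF p pre[OF n B]] emeasure_prefix_set[OF p B])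
  qed
  show "distr ?M ?M F = ?M"
  proof (rule measure_eqI_PiM_infinite[where I = UNIV and M = "\<lambda>_. uniform_count_measure {0..<int p}"])
    fix J :: "nat set" and A assume J: "finite J"
    let ?B = "prod_emb UNIV (\<lambda>_. uniform_count_measure {0..<int p}) J (PiE J A)"
    obtain m where m: "\<forall>j\<in>J. j < m" using J finite_nat_set_iff_bounded by auto
    have "prefix_set p (max N m) ?B"
    proof -
      have B: "?B = {x \<in> digits p. \<forall>j\<in>J. x j \<in> A j}"
        by (auto simp: prod_emb_def digits_def space_uniform_count_measure PiE_iff)
      show ?thesis unfolding B using m by (fastforce simp: prefix_set_def cylinder_def)
    qed
    from eq[OF this] sets_prefix_set[OF p this] 
    show "emeasure (distr ?M ?M F) ?B = emeasure ?M ?B" by (simp add: emeasure_distr[OF meas])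
  next
    show "finite_measure (distr ?M ?M F)"
      using prob_space.prob_space_distr[OF prob_space_digit_measure[OF p] meas]
      by (rule prob_space.finite_measure)
  qed (simp_all add: digit_measure_def)
qed


section \<open>Long blocks have a decisive majority\<close>

definition digit_count :: "nat set \<Rightarrow> (nat \<Rightarrow> int) \<Rightarrow> int \<Rightarrow> nat" where
  "digit_count I x v = card {i \<in> I. x i = v}"

text \<open>The margin is \<open>2 * k\<close> because changing \<open>k\<close> digits of the block changes the difference of two counts
  by at most that much.\<close>

definition decisive :: "nat \<Rightarrow> nat \<Rightarrow> nat set \<Rightarrow> (nat \<Rightarrow> int) \<Rightarrow> bool" where
  "decisive p k I x \<longleftrightarrow> (\<exists>v\<in>{0..<int p}. \<forall>w\<in>{0..<int p}. w \<noteq> v \<longrightarrow>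
     digit_count I x w + 2 * k < digit_count I x v)"

lemma isCont_cdf_std_normal: "isCont (cdf std_normal_distribution) x"
proof -
  interpret real_distribution std_normal_distribution by (rule real_dist_normal_dist)
  have "AE y in lborel. y \<in> {x} \<longrightarrow> ennreal (std_normal_density y) = 0"
    using AE_lborel_singleton[of x] by eventually_elim simp
  then have "{x} \<in> null_sets std_normal_distribution"
    by (subst null_sets_density_iff) auto
  then have "emeasure std_normal_distribution {x} = 0" by auto
  then show ?thesis by (simp add: isCont_cdf measure_def)
qed

text \<open>After normalisation the interval \<open>[-K, K]\<close> shrinks to a point, and the normal
  distribution has no atom.\<close>

lemma (in prob_space) prob_bounded_sum_tendsto_0:
  fixes X :: "nat \<Rightarrow> 'a \<Rightarrow> real"
  assumes indep: "indep_vars (\<lambda>i. borel) X UNIV"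
    and mean: "\<And>n. expectation (X n) = 0"
    and "\<sigma> > 0"
    and sq: "\<And>n. integrable M (\<lambda>x. (X n x)\<^sup>2)"
    and var: "\<And>n. variance (X n) = \<sigma>\<^sup>2"
    and distr: "\<And>n. distr M borel (X n) = \<mu>"
  shows "(\<lambda>n. prob {x \<in> space M. \<bar>\<Sum>i<n. X i x\<bar> \<le> K}) \<longlonglongrightarrow> 0"
proof -
  let ?F = "cdf std_normal_distribution"
  have rv [measurable]: "random_variable borel (X n)" for n
    using indep unfolding indep_vars_def2 by simp
  define Z where "Z n x = (\<Sum>i<n. X i x) / sqrt (n * \<sigma>\<^sup>2)" for n x
  have Zm [measurable]: "Z n \<in> borel_measurable M" for n unfolding Z_def by measurable
  have conv: "(\<lambda>n. cdf (distr M borel (Z n)) x) \<longlonglongrightarrow> ?F x" for x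
    using central_limit_theorem_zero_mean[OF indep mean \<open>\<sigma> > 0\<close> sq var distr] isCont_cdf_std_normal
    unfolding weak_conv_m_def weak_conv_def Z_def by blast
  show ?thesis
  proof (rule order_tendstoI)
    fix \<epsilon> :: real assume "0 < \<epsilon>"
    have "((\<lambda>d. ?F d - ?F (- d)) \<longlongrightarrow> ?F 0 - ?F (- 0)) (at 0)"
      using isCont_cdf_std_normal by (intro tendsto_intros isCont_tendsto_compose[of _ ?F]) auto
    then have "\<forall>\<^sub>F d in at 0. ?F d - ?F (- d) < \<epsilon>"
      using \<open>0 < \<epsilon>\<close> by (intro order_tendstoD(2)) auto
    then have "\<forall>\<^sub>F d in at_right 0. ?F d - ?F (- d) < \<epsilon>"
      by (rule eventually_at_split[THEN iffD1, THEN conjunct2])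
    then have "\<exists>d>0. ?F d - ?F (- d) < \<epsilon>"
      by (metis (mono_tags, lifting) dense eventually_at_right_field zero_less_one)
    then obtain d where d: "d > 0" "?F d - ?F (- d) < \<epsilon>" by blast
    have "(\<lambda>n. cdf (distr M borel (Z n)) d - cdf (distr M borel (Z n)) (- d)) \<longlonglongrightarrow> ?F d - ?F (- d)"
      by (intro tendsto_diff conv)
    then have "\<forall>\<^sub>F n in sequentially. cdf (distr M borel (Z n)) d - cdf (distr M borel (Z n)) (- d) < \<epsilon>"
      using d(2) by (rule order_tendstoD(2))
    moreover have "\<forall>\<^sub>F n in sequentially. K < d * sqrt (real n * \<sigma>\<^sup>2)"
    proof -
      have "filterlim (\<lambda>n. d * \<sigma> * sqrt (real n)) at_top sequentially"
        using d(1) \<open>\<sigma> > 0\<close>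
        by (intro filterlim_tendsto_pos_mult_at_top[OF tendsto_const]
            filterlim_compose[OF sqrt_at_top filterlim_real_sequentially]) simp
      then have "\<forall>\<^sub>F n in sequentially. K < d * \<sigma> * sqrt (real n)" by (simp add: filterlim_at_top_dense)
      then show ?thesis using \<open>\<sigma> > 0\<close> by (simp add: real_sqrt_mult mult_ac)
    qed
    moreover have "\<forall>\<^sub>F n in sequentially. n > (0::nat)" by (rule eventually_gt_at_top)
    ultimately show "\<forall>\<^sub>F n in sequentially. prob {x \<in> space M. \<bar>\<Sum>i<n. X i x\<bar> \<le> K} < \<epsilon>"
    proof eventually_elim
      case (elim n)
      have s: "sqrt (real n * \<sigma>\<^sup>2) > 0" using elim(3) \<open>\<sigma> > 0\<close> by simp
      interpret Z: real_distribution "distr M borel (Z n)" by (rule real_distribution_distr) simp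
      have "{x \<in> space M. \<bar>\<Sum>i<n. X i x\<bar> \<le> K} \<subseteq> Z n -` {-d<..d} \<inter> space M"
      proof
        fix x assume x: "x \<in> {x \<in> space M. \<bar>\<Sum>i<n. X i x\<bar> \<le> K}"
        then have "\<bar>\<Sum>i<n. X i x\<bar> < d * sqrt (real n * \<sigma>\<^sup>2)" using elim(2) by auto
        then have "\<bar>Z n x\<bar> < d"
          using s by (simp add: Z_def pos_divide_less_eq)
        then show "x \<in> Z n -` {-d<..d} \<inter> space M" using x by auto
      qed
      then have "prob {x \<in> space M. \<bar>\<Sum>i<n. X i x\<bar> \<le> K} \<le> prob (Z n -` {-d<..d} \<inter> space M)"
        by (intro finite_measure_mono) measurable
      also have "\<dots> = measure (distr M borel (Z n)) {-d<..d}" by (rule measure_distr[symmetric]) auto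
      also have "\<dots> = cdf (distr M borel (Z n)) d - cdf (distr M borel (Z n)) (- d)"
        using d(1) by (subst Z.cdf_diff_eq) auto
      finally show ?case using elim(1) by simp
    qed
  qed (simp add: measure_nonneg less_le_trans)
qed

lemma indep_digits:
  assumes "p > 0"
  shows "prob_space.indep_vars (digit_measure p) (\<lambda>_. uniform_count_measure {0..<int p}) (\<lambda>i x. x (a + i)) UNIV"
proof -
  interpret prob_space "digit_measure p" by (rule prob_space_digit_measure[OF assms])
  let ?U = "uniform_count_measure {0..<int p}"
  have m: "(\<lambda>x. x i) \<in> measurable (digit_measure p) ?U" for i
    unfolding digit_measure_def by (rule measurable_component_singleton) simp
  have d: "distr (digit_measure p) ?U (\<lambda>x. x i) = ?U" for i
    unfolding digit_measure_def using distr_PiM_component[of UNIV "\<lambda>_. ?U" i] prob_space_digit[OF assms] by simp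
  have "distr (digit_measure p) (PiM UNIV (\<lambda>_. ?U)) (\<lambda>x. \<lambda>i\<in>UNIV. x (a + i)) = PiM UNIV (\<lambda>_. ?U)"
    unfolding digit_measure_def
    using distr_PiM_reindex[of UNIV "\<lambda>_. ?U" "\<lambda>i. a + i" UNIV] prob_space_digit[OF assms] by simp
  then show ?thesis
    by (subst indep_vars_iff_distr_eq_PiM) (use m d in auto)
qed

text \<open>The difference of the two counts is a random walk whose steps are 1, -1 and 0, with mean 0 and
  variance \<open>2 / p\<close>.\<close>

lemma count_difference_tendsto_0:
  assumes p: "p > 0" and vw: "v \<in> {0..<int p}" "w \<in> {0..<int p}" "v \<noteq> w"
  shows "(\<lambda>n. measure (digit_measure p) {x \<in> digits p.
      \<bar>real (digit_count {a..<a+n} x v) - real (digit_count {a..<a+n} x w)\<bar> \<le> K}) \<longlonglongrightarrow> 0"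
proof -
  interpret prob_space "digit_measure p" by (rule prob_space_digit_measure[OF p])
  let ?U = "uniform_count_measure {0..<int p}"
  define f :: "int \<Rightarrow> real" where "f y = of_bool (y = v) - of_bool (y = w)" for y
  define X where "X i x = f (x (a + i))" for i and x :: "nat \<Rightarrow> int"
  have fm: "f \<in> borel_measurable ?U" by (simp add: measurable_cong_sets[OF sets_uniform_count_measure_count_space refl])
  have m: "(\<lambda>x. x i) \<in> measurable (digit_measure p) ?U" for i
    unfolding digit_measure_def by (rule measurable_component_singleton) simp
  have d: "distr (digit_measure p) ?U (\<lambda>x. x i) = ?U" for i
    unfolding digit_measure_def using distr_PiM_component[of UNIV "\<lambda>_. ?U" i] prob_space_digit[OF p] by simp
  have E: "expectation (\<lambda>x. g (x i)) = (\<Sum>y\<in>{0..<int p}. g y) / p" for g :: "int \<Rightarrow> real" and i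
  proof -
    have gm: "g \<in> borel_measurable ?U" by (simp add: measurable_cong_sets[OF sets_uniform_count_measure_count_space refl])
    have "expectation (\<lambda>x. g (x i)) = integral\<^sup>L (distr (digit_measure p) ?U (\<lambda>x. x i)) g"
      by (rule integral_distr[OF m gm, symmetric])
    also have "\<dots> = (\<Sum>y\<in>{0..<int p}. g y) / p"
      unfolding d unfolding uniform_count_measure_def
      by (subst lebesgue_integral_point_measure_finite) (auto simp: sum_divide_distrib)
    finally show ?thesis .
  qed
  have sumd: "(\<Sum>y\<in>{0..<int p}. of_bool (y = u) :: real) = 1" if "u \<in> {0..<int p}" for u
    using that by (simp add: of_bool_def sum.delta)
  have mean: "expectation (X i) = 0" for i
    unfolding X_def E using sumd[OF vw(1)] sumd[OF vw(2)] by (simp add: f_def sum_subtractf)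
  have f2: "(f y)\<^sup>2 = of_bool (y = v) + of_bool (y = w)" for y using vw(3) by (auto simp: f_def)
  have E2: "expectation (\<lambda>x. (X i x)\<^sup>2) = 2 / p" for i
  proof -
    have "expectation (\<lambda>x. (X i x)\<^sup>2) = (\<Sum>y\<in>{0..<int p}. (f y)\<^sup>2) / p"
      unfolding X_def by (rule E)
    then show ?thesis unfolding f2 sum.distrib sumd[OF vw(1)] sumd[OF vw(2)] by simp
  qed
  have Xm: "X i \<in> borel_measurable (digit_measure p)" for i
    unfolding X_def by (rule measurable_compose[OF m fm])
  have lim: "(\<lambda>n. prob {x \<in> space (digit_measure p). \<bar>\<Sum>i<n. X i x\<bar> \<le> K}) \<longlonglongrightarrow> 0"
  proof (rule prob_bounded_sum_tendsto_0[where \<sigma> = "sqrt (2 / p)" and \<mu> = "distr ?U borel f"])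
    show "indep_vars (\<lambda>_. borel) X UNIV"
      unfolding X_def by (rule indep_vars_compose2[OF indep_digits[OF p]]) (rule fm)
    show "integrable (digit_measure p) (\<lambda>x. (X i x)\<^sup>2)" for i
    proof (rule integrable_const_bound[where B = 1])
      show "(\<lambda>x. (X i x)\<^sup>2) \<in> borel_measurable (digit_measure p)" using Xm by measurable
      show "AE x in digit_measure p. norm ((X i x)\<^sup>2) \<le> 1" using vw(3) by (auto simp: X_def f2)
    qed
    show "variance (X i) = (sqrt (2 / p))\<^sup>2" for i using E2 by (simp add: mean)
    show "distr (digit_measure p) borel (X i) = distr ?U borel f" for i
      using distr_distr[OF fm m[of "a + i"]] unfolding d X_def by (simp add: comp_def)
  qed (use p mean in auto)
  have S: "(\<Sum>i<n. X i x) = real (digit_count {a..<a+n} x v) - real (digit_count {a..<a+n} x w)" for n x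
  proof -
    have "(\<Sum>i<n. of_bool (x (a + i) = u) :: real) = real (digit_count {a..<a+n} x u)" for u
    proof -
      have "{j \<in> {a..<a+n}. x j = u} = (\<lambda>i. a + i) ` {i \<in> {..<n}. x (a + i) = u}"
        by (auto simp: image_iff) (metis add_diff_inverse_nat less_diff_conv2 not_less add.commute)
      then have "digit_count {a..<a+n} x u = card {i \<in> {..<n}. x (a + i) = u}"
        by (simp add: digit_count_def card_image)
      then show ?thesis by (simp add: sum_of_bool_eq Int_def)
    qed
    then show ?thesis by (simp add: X_def f_def sum_subtractf)
  qed
  show ?thesis using lim unfolding S by simp
qed

lemma indecisive_close_counts:
  assumes "p > 0" "\<not> decisive p k I x"
  shows "\<exists>v\<in>{0..<int p}. \<exists>w\<in>{0..<int p}. v \<noteq> w \<and>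
    \<bar>real (digit_count I x v) - real (digit_count I x w)\<bar> \<le> 2 * k"
proof -
  let ?c = "digit_count I x"
  have "finite (?c ` {0..<int p})" "?c ` {0..<int p} \<noteq> {}" using assms(1) by auto
  then have "Max (?c ` {0..<int p}) \<in> ?c ` {0..<int p}" by (rule Max_in)
  then obtain v where v: "v \<in> {0..<int p}" "?c v = Max (?c ` {0..<int p})" by auto
  have max: "?c w \<le> ?c v" if "w \<in> {0..<int p}" for w
    unfolding v(2) using that by (intro Max_ge) auto
  obtain w where w: "w \<in> {0..<int p}" "w \<noteq> v" "?c v \<le> ?c w + 2 * k"
    using assms(2) v(1) unfolding decisive_def by (meson not_less)
  have "\<bar>real (?c v) - real (?c w)\<bar> \<le> 2 * k" using w(3) max[OF w(1)] by linarith
  then show ?thesis using v(1) w(1,2) by (intro bexI[of _ v] bexI[of _ w]) auto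
qed

lemma decisive_cong:
  assumes "\<And>i. i \<in> I \<Longrightarrow> x i = y i"
  shows "digit_count I x = digit_count I y" "decisive p k I x = decisive p k I y"
proof -
  have "{i \<in> I. x i = v} = {i \<in> I. y i = v}" for v using assms by auto
  then show "digit_count I x = digit_count I y" by (simp add: digit_count_def fun_eq_iff)
  then show "decisive p k I x = decisive p k I y" by (simp add: decisive_def)
qed

lemma prefix_set_Collect:
  assumes "\<And>x y. (\<And>i. i < n \<Longrightarrow> x i = y i) \<Longrightarrow> P x = P y"
  shows "prefix_set p n {x \<in> digits p. P x}"
  unfolding prefix_set_def cylinder_def
proof (intro conjI ballI subsetI)
  fix x y assume "x \<in> {x \<in> digits p. P x}" "y \<in> {y \<in> digits p. \<forall>i<n. y i = x i}"
  then show "y \<in> {x \<in> digits p. P x}" using assms[of y x] by simp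
qed auto

lemma sets_decisive:
  assumes "p > 0" "finite I"
  shows "{x \<in> digits p. \<not> decisive p k I x} \<in> sets (digit_measure p)"
proof -
  obtain n where n: "\<forall>i\<in>I. i < n" using assms(2) finite_nat_set_iff_bounded by auto
  have "prefix_set p n {x \<in> digits p. \<not> decisive p k I x}"
    by (rule prefix_set_Collect, subst decisive_cong(2)) (use n in auto)
  then show ?thesis by (rule sets_prefix_set[OF assms(1)])
qed

lemma rare_indecisive:
  assumes p: "p > 0" and "\<epsilon> > 0"
  shows "\<exists>n>m. measure (digit_measure p) {x \<in> digits p. \<not> decisive p k {a..<a+n} x} < \<epsilon>"
proof -
  interpret prob_space "digit_measure p" by (rule prob_space_digit_measure[OF p])
  define C where "C n v w = {x \<in> digits p.
    \<bar>real (digit_count {a..<a+n} x v) - real (digit_count {a..<a+n} x w)\<bar> \<le> 2 * k}" for n v w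
  define P where "P = {(v, w). v \<in> {0..<int p} \<and> w \<in> {0..<int p} \<and> v \<noteq> w}"
  have finP: "finite P" by (rule finite_subset[of _ "{0..<int p} \<times> {0..<int p}"]) (auto simp: P_def)
  have Cm: "C n v w \<in> events" for n v w
    unfolding C_def
  proof (rule sets_prefix_set[OF p, of "a + n"], rule prefix_set_Collect)
    fix x y :: "nat \<Rightarrow> int" assume "\<And>i. i < a + n \<Longrightarrow> x i = y i"
    then have "digit_count {a..<a+n} x = digit_count {a..<a+n} y"
      by (intro decisive_cong(1)) simp
    then show "(\<bar>real (digit_count {a..<a+n} x v) - real (digit_count {a..<a+n} x w)\<bar> \<le> 2 * k) =
        (\<bar>real (digit_count {a..<a+n} y v) - real (digit_count {a..<a+n} y w)\<bar> \<le> 2 * k)"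
      by simp
  qed
  have "(\<lambda>n. \<Sum>(v, w)\<in>P. prob (C n v w)) \<longlonglongrightarrow> (\<Sum>(v, w)\<in>P. 0)"
    by (rule tendsto_sum) (use count_difference_tendsto_0[OF p] in \<open>auto simp: C_def P_def\<close>)
  then have "\<forall>\<^sub>F n in sequentially. (\<Sum>(v, w)\<in>P. prob (C n v w)) < \<epsilon>"
    using \<open>\<epsilon> > 0\<close> by (intro order_tendstoD(2)) auto
  then have "\<forall>\<^sub>F n in sequentially. m < n \<and> (\<Sum>(v, w)\<in>P. prob (C n v w)) < \<epsilon>"
    using eventually_gt_at_top by (rule eventually_conj[rotated])
  then obtain n where n: "m < n" "(\<Sum>(v, w)\<in>P. prob (C n v w)) < \<epsilon>"
    unfolding eventually_sequentially by blast
  have "{x \<in> digits p. \<not> decisive p k {a..<a+n} x} \<subseteq> (\<Union>(v, w)\<in>P. C n v w)"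
    using indecisive_close_counts[OF p] by (fastforce simp: C_def P_def)
  then have "prob {x \<in> digits p. \<not> decisive p k {a..<a+n} x} \<le> prob (\<Union>(v, w)\<in>P. C n v w)"
    using Cm finP by (intro finite_measure_mono sets.finite_UN) auto
  also have "\<dots> \<le> (\<Sum>(v, w)\<in>P. prob (C n v w))"
    using measure_UNION_le[OF finP, of "\<lambda>(v, w). C n v w" "digit_measure p"] Cm
    by (auto simp: case_prod_beta)
  finally show ?thesis using n by auto
qed


section \<open>The skewed translation action\<close>

definition translate :: "nat \<Rightarrow> (nat \<Rightarrow> int) \<Rightarrow> (nat \<Rightarrow> int) \<Rightarrow> nat \<Rightarrow> int" where
  "translate p v x = (\<lambda>i. (x i + v i) mod int p)"

lemma translate_digits: "p > 0 \<Longrightarrow> translate p v x \<in> digits p"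
  by (simp add: translate_def digits_def)

lemma translate_translate: "translate p v (translate p w x) = translate p (\<lambda>i. v i + w i) x"
  by (simp add: translate_def mod_simps add_ac)

lemma translate_commute: "translate p v (translate p w x) = translate p w (translate p v x)"
  by (simp add: translate_translate add.commute)

lemma translate_mod: "translate p (\<lambda>i. v i mod int p) x = translate p v x"
  by (simp add: translate_def mod_simps)

lemma translate_unchanged: "x \<in> digits p \<Longrightarrow> v i = 0 \<Longrightarrow> translate p v x i = x i"
  by (simp add: translate_def digits_def)

lemma translate_zero: "x \<in> digits p \<Longrightarrow> translate p (\<lambda>i. 0) x = x"
  by (rule ext) (simp add: translate_unchanged)

definition majority :: "nat \<Rightarrow> nat set \<Rightarrow> (nat \<Rightarrow> int) \<Rightarrow> int" where
  "majority p I x = (SOME v. v \<in> {0..<int p} \<and> (\<forall>w\<in>{0..<int p}. digit_count I x w \<le> digit_count I x v))"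

lemma majority_cong: "(\<And>i. i \<in> I \<Longrightarrow> x i = y i) \<Longrightarrow> majority p I x = majority p I y"
  unfolding majority_def by (simp only: decisive_cong(1)[of I x y])

lemma majority_eqI:
  assumes v: "v \<in> {0..<int p}"
    and "\<And>w. w \<in> {0..<int p} \<Longrightarrow> w \<noteq> v \<Longrightarrow> digit_count I x w < digit_count I x v"
  shows "majority p I x = v"
  unfolding majority_def
proof (rule some_equality)
  fix u assume u: "u \<in> {0..<int p} \<and> (\<forall>w\<in>{0..<int p}. digit_count I x w \<le> digit_count I x u)"
  then have "digit_count I x v \<le> digit_count I x u" using v by blast
  then show "u = v" using assms(2)[of u] u by (cases "u = v") auto
next
  have "digit_count I x w \<le> digit_count I x v" if "w \<in> {0..<int p}" for w
    using assms(2)[OF that] by (cases "w = v") auto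
  then show "v \<in> {0..<int p} \<and> (\<forall>w\<in>{0..<int p}. digit_count I x w \<le> digit_count I x v)"
    using v by blast
qed

text \<open>Adding 1 to every digit would shift all the counts. The at most \<open>k\<close> exceptional coordinates
  disturb each count by at most \<open>k\<close>, which the margin of \<open>2 * k\<close> tolerates.\<close>

lemma majority_translate_near_ones:
  assumes p: "p > 0" and I: "finite I" and x: "x \<in> digits p"
    and dec: "decisive p k I x" and e: "e \<in> near_ones p I k"
    and y: "\<And>i. i \<in> I \<Longrightarrow> y i = (x i + e i) mod int p"
  shows "majority p I y = (majority p I x + 1) mod int p"
proof -
  obtain v where v: "v \<in> {0..<int p}"
    and big: "\<And>w. w \<in> {0..<int p} \<Longrightarrow> w \<noteq> v \<Longrightarrow> digit_count I x w + 2 * k < digit_count I x v"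
    using dec unfolding decisive_def by blast
  have xv: "majority p I x = v" by (rule majority_eqI[OF v]) (use big add_lessD1 in blast)
  define Z where "Z = {i \<in> I. e i \<noteq> 1}"
  have Z: "finite Z" "card Z \<le> k" using I e by (auto simp: Z_def near_ones_def)
  have eq: "x i = w \<longleftrightarrow> y i = (w + 1) mod int p" if "i \<in> I - Z" "w \<in> {0..<int p}" for i w
  proof -
    have "x i \<in> {0..<int p}" using x by (simp add: digits_def)
    then have "x i = w \<longleftrightarrow> x i mod int p = w mod int p" using that(2) by simp
    also have "\<dots> \<longleftrightarrow> (x i + 1) mod int p = (w + 1) mod int p" by (simp add: mod_eq_dvd_iff)
    finally show ?thesis using y[of i] that(1) by (simp add: Z_def)
  qed
  have le1: "digit_count I y ((w + 1) mod int p) \<le> digit_count I x w + k" if "w \<in> {0..<int p}" for w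
  proof -
    have "{i \<in> I. y i = (w + 1) mod int p} \<subseteq> {i \<in> I. x i = w} \<union> Z" using eq that by blast
    then have "digit_count I y ((w + 1) mod int p) \<le> card ({i \<in> I. x i = w} \<union> Z)"
      unfolding digit_count_def using I Z by (intro card_mono) auto
    also have "\<dots> \<le> digit_count I x w + card Z" unfolding digit_count_def by (rule card_Un_le)
    finally show ?thesis using Z by simp
  qed
  have le2: "digit_count I x w \<le> digit_count I y ((w + 1) mod int p) + k" if "w \<in> {0..<int p}" for w
  proof -
    have "{i \<in> I. x i = w} \<subseteq> {i \<in> I. y i = (w + 1) mod int p} \<union> Z" using eq that by blast
    then have "digit_count I x w \<le> card ({i \<in> I. y i = (w + 1) mod int p} \<union> Z)"
      unfolding digit_count_def using I Z by (intro card_mono) auto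
    also have "\<dots> \<le> digit_count I y ((w + 1) mod int p) + card Z" unfolding digit_count_def by (rule card_Un_le)
    finally show ?thesis using Z by simp
  qed
  show ?thesis unfolding xv
  proof (rule majority_eqI)
    show "(v + 1) mod int p \<in> {0..<int p}" using p by simp
    fix w assume w: "w \<in> {0..<int p}" "w \<noteq> (v + 1) mod int p"
    define w' where "w' = (w - 1) mod int p"
    have w': "w' \<in> {0..<int p}" "(w' + 1) mod int p = w" using p w by (auto simp: w'_def mod_simps)
    then have "w' \<noteq> v" using w by blast
    then show "digit_count I y w < digit_count I y ((v + 1) mod int p)"
      using le1[OF w'(1)] le2[OF v] big[OF w'(1)] w'(2) by simp
  qed
qed

text \<open>The property of \<open>prefix_respecting_measure_preserving\<close>, which unlike that of preserving the
  measure is checked digit by digit.\<close>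

definition respects_prefixes :: "nat \<Rightarrow> nat \<Rightarrow> ((nat \<Rightarrow> int) \<Rightarrow> nat \<Rightarrow> int) \<Rightarrow> bool" where
  "respects_prefixes p N F \<longleftrightarrow> bij_betw F (digits p) (digits p) \<and>
     (\<forall>n\<ge>N. \<forall>x\<in>digits p. \<forall>y\<in>digits p. (\<forall>i<n. F x i = F y i) \<longleftrightarrow> (\<forall>i<n. x i = y i))"

lemma respects_prefixes_comp:
  assumes "respects_prefixes p N F" "respects_prefixes p N H"
  shows "respects_prefixes p N (\<lambda>x. F (H x))"
proof -
  have "bij_betw (F \<circ> H) (digits p) (digits p)"
    using assms by (auto simp: respects_prefixes_def intro: bij_betw_trans)
  moreover have "H x \<in> digits p" if "x \<in> digits p" for x
    using assms that by (auto simp: respects_prefixes_def bij_betw_def)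
  ultimately show ?thesis
    using assms unfolding respects_prefixes_def comp_def by simp
qed

lemma respects_prefixes_mono: "respects_prefixes p m F \<Longrightarrow> m \<le> n \<Longrightarrow> respects_prefixes p n F"
  by (simp add: respects_prefixes_def)

lemma respects_prefixes_inverse:
  assumes F: "respects_prefixes p N F"
    and H: "\<And>x. x \<in> digits p \<Longrightarrow> H x \<in> digits p" "\<And>x. x \<in> digits p \<Longrightarrow> F (H x) = x"
      "\<And>x. x \<in> digits p \<Longrightarrow> H (F x) = x"
  shows "respects_prefixes p N H"
proof -
  have FD: "F x \<in> digits p" if "x \<in> digits p" for x
    using F that by (auto simp: respects_prefixes_def bij_betw_def)
  have "bij_betw H (digits p) (digits p)"
    by (rule bij_betw_byWitness[where f' = F]) (use H FD in auto)
  moreover have "(\<forall>i<n. H x i = H y i) \<longleftrightarrow> (\<forall>i<n. x i = y i)"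
    if "N \<le> n" "x \<in> digits p" "y \<in> digits p" for n x y
  proof -
    have "(\<forall>i<n. F (H x) i = F (H y) i) \<longleftrightarrow> (\<forall>i<n. H x i = H y i)"
      using F that H(1) unfolding respects_prefixes_def by blast
    then show ?thesis using that H(2) by simp
  qed
  ultimately show ?thesis by (simp add: respects_prefixes_def)
qed

lemma respects_prefixes_translate:
  assumes "p > 0"
  shows "respects_prefixes p N (translate p v)"
proof -
  have inv: "translate p (\<lambda>i. - v i) (translate p v x) = x" "translate p v (translate p (\<lambda>i. - v i) x) = x"
    if "x \<in> digits p" for x
    using that by (simp_all add: translate_translate translate_zero)
  have "bij_betw (translate p v) (digits p) (digits p)"
    by (rule bij_betw_byWitness[where f' = "translate p (\<lambda>i. - v i)"]) (use assms inv translate_digits in auto)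
  moreover have "translate p v x i = translate p v y i \<longleftrightarrow> x i = y i" if "x \<in> digits p" "y \<in> digits p" for x y i
  proof -
    have "translate p v x i = translate p v y i \<longleftrightarrow> x i mod int p = y i mod int p"
      by (simp add: translate_def mod_eq_dvd_iff)
    also have "\<dots> \<longleftrightarrow> x i = y i" using that by (simp add: digits_def)
    finally show ?thesis .
  qed
  ultimately show ?thesis by (simp add: respects_prefixes_def)
qed

text \<open>Coordinate 0 lies before all the blocks: it is the place where the majority of every block leaves
  its trace.\<close>

locale skew_action =
  fixes p :: nat and a :: "nat \<Rightarrow> nat" and t :: "nat \<Rightarrow> nat \<Rightarrow> int"
  assumes p: "p > 1" and a_pos: "0 < a 0" and a_less: "a j < a (Suc j)"
    and t_supp: "a j \<le> i \<Longrightarrow> t j i = 0"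
begin

abbreviation block :: "nat \<Rightarrow> nat set" where "block j \<equiv> {a j..<a (Suc j)}"

text \<open>The vector \<open>t\<^sub>j + \<delta>\<^sub>0\<close> of the overview. Skewing by it changes no digit of block \<open>j\<close>,
  so the majority survives and the skewing can be undone.\<close>

definition u :: "nat \<Rightarrow> nat \<Rightarrow> int" where "u j i = t j i + of_bool (i = 0)"

definition skew :: "nat \<Rightarrow> (nat \<Rightarrow> int) \<Rightarrow> nat \<Rightarrow> int" where
  "skew j x = translate p (\<lambda>i. majority p (block j) x * u j i) x"

definition unskew :: "nat \<Rightarrow> (nat \<Rightarrow> int) \<Rightarrow> nat \<Rightarrow> int" where
  "unskew j x = translate p (\<lambda>i. - majority p (block j) x * u j i) x"

fun skews :: "nat \<Rightarrow> (nat \<Rightarrow> int) \<Rightarrow> nat \<Rightarrow> int" where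
  "skews 0 x = x" | "skews (Suc j) x = skew j (skews j x)"

fun unskews :: "nat \<Rightarrow> (nat \<Rightarrow> int) \<Rightarrow> nat \<Rightarrow> int" where
  "unskews 0 x = x" | "unskews (Suc j) x = unskews j (unskew j x)"

lemma p0: "p > 0" using p by simp

lemma a_mono: "i \<le> j \<Longrightarrow> a i \<le> a j"
  by (rule lift_Suc_mono_le[of a]) (simp_all add: a_less less_imp_le)

lemma a_gt: "j < a j"
proof (induction j)
  case (Suc j)
  then show ?case using a_less[of j] by simp
qed (rule a_pos)

lemma u_supp: "a j \<le> i \<Longrightarrow> u j i = 0"
  using a_mono[of 0 j] a_pos t_supp[of j i] by (auto simp: u_def)

lemma majority_translate:
  assumes "x \<in> digits p" "\<And>i. i \<in> I \<Longrightarrow> v i = 0"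
  shows "majority p I (translate p v x) = majority p I x"
  by (rule majority_cong) (use assms in \<open>simp add: translate_unchanged\<close>)

lemma skew_digits: "skew j x \<in> digits p" "unskew j x \<in> digits p"
  by (simp_all add: skew_def unskew_def translate_digits p0)

lemma majority_skew:
  assumes "x \<in> digits p"
  shows "majority p (block j) (skew j x) = majority p (block j) x"
    "majority p (block j) (unskew j x) = majority p (block j) x"
  unfolding skew_def unskew_def by (rule majority_translate[OF assms]; simp add: u_supp)+

lemma unskew_skew: "x \<in> digits p \<Longrightarrow> unskew j (skew j x) = x"
  by (subst unskew_def, subst majority_skew) (simp_all add: skew_def translate_translate translate_zero)

lemma skew_unskew: "x \<in> digits p \<Longrightarrow> skew j (unskew j x) = x"
  by (subst skew_def, subst majority_skew) (simp_all add: unskew_def translate_translate translate_zero)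

text \<open>A translation that does not touch block \<open>j\<close> does not change the majority there. Hence conjugation by
  the \<open>j\<close>-th skewing affects only elements of the group that meet block \<open>j\<close>, and the infinite
  composition of all skewings may be cut off at a finite stage.\<close>

lemma skew_translate:
  assumes "x \<in> digits p" "\<And>i. i \<in> block j \<Longrightarrow> v i = 0"
  shows "skew j (translate p v x) = translate p v (skew j x)"
proof -
  have "majority p (block j) (translate p v x) = majority p (block j) x"
    by (rule majority_translate) (use assms in auto)
  then show ?thesis unfolding skew_def by (simp only: translate_commute[of p v])
qed

lemma skews_digits: "x \<in> digits p \<Longrightarrow> skews j x \<in> digits p"
  by (cases j) (simp_all add: skew_digits)

lemma unskews_digits: "x \<in> digits p \<Longrightarrow> unskews j x \<in> digits p"
  by (induction j arbitrary: x) (simp_all add: skew_digits)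

lemma unskews_skews: "x \<in> digits p \<Longrightarrow> unskews j (skews j x) = x"
  by (induction j) (simp_all add: unskew_skew skews_digits)

lemma skews_unskews: "x \<in> digits p \<Longrightarrow> skews j (unskews j x) = x"
  by (induction j arbitrary: x) (simp_all add: skew_unskew skew_digits)

lemma skews_translate:
  assumes "x \<in> digits p" "\<And>i. a 0 \<le> i \<Longrightarrow> i < a j \<Longrightarrow> v i = 0"
  shows "skews j (translate p v x) = translate p v (skews j x)"
  using assms
proof (induction j)
  case (Suc j)
  have "skews j (translate p v x) = translate p v (skews j x)"
    using Suc.prems a_less[of j] by (intro Suc.IH) auto
  moreover have "skew j (translate p v (skews j x)) = translate p v (skew j (skews j x))"
    using Suc.prems a_mono[of 0 j] by (intro skew_translate skews_digits) auto
  ultimately show ?case by simp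
qed simp

lemma skews_unchanged: "x \<in> digits p \<Longrightarrow> a j \<le> i \<Longrightarrow> skews j x i = x i"
proof (induction j)
  case (Suc j)
  then have i: "a j \<le> i" using a_less[of j] by simp
  have "skews (Suc j) x i = skews j x i"
    by (simp add: skew_def translate_unchanged[OF skews_digits[OF Suc.prems(1)]] u_supp[OF i])
  then show ?case using Suc.IH Suc.prems i by simp
qed simp

definition conj_translate :: "nat \<Rightarrow> (nat \<Rightarrow> int) \<Rightarrow> (nat \<Rightarrow> int) \<Rightarrow> nat \<Rightarrow> int" where
  "conj_translate j g x = unskews j (translate p g (skews j x))"

lemma conj_translate_stable:
  assumes "\<And>i. a j \<le> i \<Longrightarrow> g i = 0" "j \<le> k" "x \<in> digits p"
  shows "conj_translate k g x = conj_translate j g x"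
  using assms(2)
proof (induction k rule: dec_induct)
  case (step k)
  have "translate p g (skew k (skews k x)) = skew k (translate p g (skews k x))"
    using assms(1) a_mono[OF step(1)]
    by (intro skew_translate[symmetric] skews_digits[OF assms(3)]) auto
  then have "conj_translate (Suc k) g x = conj_translate k g x"
    by (simp add: conj_translate_def unskew_skew translate_digits p0)
  then show ?case using step by simp
qed simp

text \<open>All stages from this one on give the same conjugate, see \<open>conj_translate_stable\<close>.\<close>

definition level :: "(nat \<Rightarrow> int) \<Rightarrow> nat" where
  "level g = (LEAST j. \<forall>i. a j \<le> i \<longrightarrow> g i = 0)"

definition act :: "(nat \<Rightarrow> int) \<Rightarrow> (nat \<Rightarrow> int) \<Rightarrow> nat \<Rightarrow> int" where
  "act g = (\<lambda>x\<in>digits p. conj_translate (level g) g x)"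

lemma level_le: "(\<And>i. a j \<le> i \<Longrightarrow> g i = 0) \<Longrightarrow> level g \<le> j"
  unfolding level_def by (rule Least_le) simp

lemma level_supp:
  assumes "finite {i. g i \<noteq> 0}" "a (level g) \<le> i"
  shows "g i = 0"
proof -
  obtain n where n: "\<forall>i\<in>{i. g i \<noteq> 0}. i < n" using assms(1) finite_nat_set_iff_bounded by auto
  have "\<forall>i. a n \<le> i \<longrightarrow> g i = 0" using n a_gt[of n] by fastforce
  then have "\<forall>i. a (level g) \<le> i \<longrightarrow> g i = 0" unfolding level_def by (rule LeastI)
  then show ?thesis using assms(2) by blast
qed

lemma act_eq:
  assumes "x \<in> digits p" "\<And>i. a j \<le> i \<Longrightarrow> g i = 0"
  shows "act g x = conj_translate j g x"
proof -
  have "finite {i. g i \<noteq> 0}"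
    by (rule finite_subset[of _ "{..<a j}"]) (use assms(2) in \<open>force simp: not_le[symmetric]\<close>, simp)
  then have "conj_translate j g x = conj_translate (level g) g x"
    by (intro conj_translate_stable level_supp level_le assms)
  then show ?thesis using assms(1) by (simp add: act_def)
qed

lemma act_digits: "x \<in> digits p \<Longrightarrow> act g x \<in> digits p"
  by (simp add: act_def conj_translate_def unskews_digits translate_digits p0)

lemma group_action_act: "group_action (Fp_omega p) (digits p) act"
proof (rule group_actionI[OF group_Fp_omega])
  show "act \<one>\<^bsub>Fp_omega p\<^esub> x = x" if "x \<in> digits p" for x
    using that by (simp add: act_def conj_translate_def translate_zero skews_digits unskews_skews)
  fix g h x assume gh: "g \<in> carrier (Fp_omega p)" "h \<in> carrier (Fp_omega p)" and x: "x \<in> digits p"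
  define j where "j = max (level g) (level h)"
  have fin: "finite {i. g i \<noteq> 0}" "finite {i. h i \<noteq> 0}" using gh by (auto simp: carrier_Fp_omega[OF p0])
  have gj: "g i = 0" and hj: "h i = 0" if "a j \<le> i" for i
    using level_supp[OF fin(1), of i] level_supp[OF fin(2), of i] that
      a_mono[of "level g" j] a_mono[of "level h" j] by (auto simp: j_def)
  have "act (g \<otimes>\<^bsub>Fp_omega p\<^esub> h) x = conj_translate j (g \<otimes>\<^bsub>Fp_omega p\<^esub> h) x"
    by (rule act_eq[OF x]) (simp add: gj hj)
  also have "\<dots> = conj_translate j g (conj_translate j h x)"
    by (simp add: conj_translate_def skews_unskews translate_digits p0 translate_mod[of p "\<lambda>i. g i + h i"] translate_translate)
  also have "\<dots> = act g (act h x)"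
    using act_eq[of x j h] act_eq[of "act h x" j g] x act_digits[OF x, of h] gj hj by simp
  finally show "act (g \<otimes>\<^bsub>Fp_omega p\<^esub> h) x = act g (act h x)" .
qed (simp_all add: act_digits, simp add: act_def)

text \<open>The \<open>j\<close>-th skewing adds to \<open>x\<close> a vector that is determined by the digits of \<open>x\<close>
  in block \<open>j\<close>, and so does its inverse.\<close>

lemma respects_prefixes_skew: "respects_prefixes p (a (Suc j)) (skew j)"
proof -
  have D: "skew j ` digits p \<subseteq> digits p" "unskew j ` digits p \<subseteq> digits p" using skew_digits by auto
  have "bij_betw (skew j) (digits p) (digits p)"
    by (rule bij_betw_byWitness[where f' = "unskew j"]) (use D skew_unskew unskew_skew in auto)
  moreover have "(\<forall>i<n. skew j x i = skew j y i) \<longleftrightarrow> (\<forall>i<n. x i = y i)"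
    if n: "a (Suc j) \<le> n" and xy: "x \<in> digits p" "y \<in> digits p" for n x y
  proof
    assume agree: "\<forall>i<n. x i = y i"
    then have "majority p (block j) x = majority p (block j) y"
      using n by (intro majority_cong) auto
    then show "\<forall>i<n. skew j x i = skew j y i" using agree by (simp add: skew_def translate_def)
  next
    assume agree: "\<forall>i<n. skew j x i = skew j y i"
    then have "majority p (block j) (skew j x) = majority p (block j) (skew j y)"
      using n by (intro majority_cong) auto
    then have "unskew j (skew j x) i = unskew j (skew j y) i" if "i < n" for i
      using agree that by (simp add: unskew_def translate_def)
    then show "\<forall>i<n. x i = y i" using xy by (simp add: unskew_skew)
  qed
  ultimately show ?thesis by (simp add: respects_prefixes_def)
qed

lemma respects_prefixes_skews: "respects_prefixes p (a j) (skews j)"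
proof (induction j)
  case 0
  have "bij_betw (\<lambda>x. x) (digits p) (digits p)" using bij_betw_id by (simp add: id_def)
  then show ?case by (simp add: respects_prefixes_def)
next
  case (Suc j)
  then show ?case
    using respects_prefixes_comp[OF respects_prefixes_skew[of j]] respects_prefixes_mono a_less[of j]
    by (simp add: less_imp_le)
qed

lemma respects_prefixes_act:
  assumes "g \<in> carrier (Fp_omega p)"
  shows "respects_prefixes p (a (level g)) (act g)"
proof -
  let ?j = "level g"
  have un: "respects_prefixes p (a ?j) (unskews ?j)"
    by (rule respects_prefixes_inverse[OF respects_prefixes_skews])
      (simp_all add: unskews_digits skews_unskews unskews_skews)
  have "respects_prefixes p (a ?j) (conj_translate ?j g)"
    unfolding conj_translate_def
    by (rule respects_prefixes_comp[OF un
          respects_prefixes_comp[OF respects_prefixes_translate[OF p0] respects_prefixes_skews]])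
  moreover have "bij_betw (act g) (digits p) (digits p) = bij_betw (conj_translate ?j g) (digits p) (digits p)"
    by (rule bij_betw_cong) (simp add: act_def)
  ultimately show ?thesis unfolding respects_prefixes_def by (simp add: act_def)
qed

lemma measure_preserving_act: "measure_preserving_action (Fp_omega p) (digit_measure p) act"
proof -
  have "act g \<in> measurable (digit_measure p) (digit_measure p) \<and>
      distr (digit_measure p) (digit_measure p) (act g) = digit_measure p"
    if "g \<in> carrier (Fp_omega p)" for g
  proof -
    note r = respects_prefixes_act[OF that, unfolded respects_prefixes_def]
    show ?thesis
      using prefix_respecting_measure_preserving[OF p0, of "act g" "a (level g)"] r by blast
  qed
  then show ?thesis using group_action_act by (simp add: measure_preserving_action_def)
qed

text \<open>Let \<open>y\<close> be \<open>x\<close> after the first \<open>j\<close> skewings and \<open>c\<close> its majority on block \<open>j\<close>. Translating the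
  skewed point gives \<open>y + c (t\<^sub>j + \<delta>\<^sub>0) + t\<^sub>j + e\<close>, which is also
  \<open>z + (c + 1) (t\<^sub>j + \<delta>\<^sub>0)\<close> for \<open>z = y + e - \<delta>\<^sub>0\<close>. Since \<open>z\<close> has majority \<open>c + 1\<close>, this is the skewing of
  \<open>z\<close>. The earlier skewings do not see the vector \<open>e - \<delta>\<^sub>0\<close>, because it vanishes on their blocks.\<close>

lemma act_near_ones:
  assumes x: "x \<in> digits p" and dec: "decisive p k (block j) x" and e: "e \<in> near_ones p (block j) k"
  shows "act (t j \<otimes>\<^bsub>Fp_omega p\<^esub> e) x = translate p (\<lambda>i. e i - of_bool (i = 0)) x"
proof -
  define g where "g = t j \<otimes>\<^bsub>Fp_omega p\<^esub> e"
  define d where "d = (\<lambda>i. e i - of_bool (i = 0))"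
  define y where "y = skews j x"
  define z where "z = translate p d y"
  define c where "c = majority p (block j) y"
  have yD: "y \<in> digits p" unfolding y_def by (rule skews_digits[OF x])
  have pos: "0 < a j" using a_mono[of 0 j] a_pos by simp
  have e0: "e i = 0" if "i \<notin> block j" for i using e that by (simp add: near_ones_def)
  have yx: "y i = x i" if "i \<in> block j" for i
    unfolding y_def using skews_unchanged[OF x] that by simp
  have "decisive p k (block j) y" using dec decisive_cong(2)[of "block j" y x p k] yx by simp
  then have cz: "majority p (block j) z = (c + 1) mod int p"
    unfolding c_def using e pos
    by (intro majority_translate_near_ones[OF p0 _ yD]) (auto simp: z_def translate_def d_def)
  have "skew j z = translate p g (skew j y)"
  proof
    fix i
    have "skew j z i = (y i + d i + (c + 1) * u j i) mod int p"
    proof -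
      have "skew j z i = (y i + d i + (c + 1) mod int p * u j i) mod int p"
        unfolding skew_def cz by (simp add: translate_def z_def mod_simps)
      then show ?thesis by (metis mod_add_right_eq mod_mult_left_eq)
    qed
    also have "y i + d i + (c + 1) * u j i = (y i + c * u j i) + (t j i + e i)"
      by (simp add: d_def u_def algebra_simps)
    also have "\<dots> mod int p = translate p g (skew j y) i"
      by (simp add: translate_def skew_def c_def g_def mod_simps)
    finally show "skew j z i = translate p g (skew j y) i" .
  qed
  then have "conj_translate (Suc j) g x = unskews j (unskew j (skew j z))"
    by (simp add: conj_translate_def y_def)
  also have "\<dots> = unskews j z"
    unfolding z_def by (simp add: unskew_skew translate_digits p0)
  also have "z = skews j (translate p d x)"
    unfolding z_def y_def using e0 a_pos by (intro skews_translate[symmetric] x) (auto simp: d_def)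
  also have "unskews j \<dots> = translate p d x" by (simp add: unskews_skews translate_digits p0)
  finally have "conj_translate (Suc j) g x = translate p d x" .
  moreover have "act g x = conj_translate (Suc j) g x"
    using a_less[of j] e0 t_supp by (intro act_eq[OF x]) (simp add: g_def)
  ultimately show ?thesis by (simp add: g_def d_def)
qed

definition good :: "(nat \<Rightarrow> int) set" where
  "good = {x \<in> digits p. x 0 = 0 \<and> (\<forall>j. decisive p j (block j) x)}"

lemma good_disjoint:
  assumes e: "e \<in> near_ones p (block j) j"
  shows "good \<inter> act (t j \<otimes>\<^bsub>Fp_omega p\<^esub> e) ` good = {}"
proof -
  have "act (t j \<otimes>\<^bsub>Fp_omega p\<^esub> e) x 0 \<noteq> 0" if "x \<in> good" for x
  proof -
    have x: "x \<in> digits p" "x 0 = 0" "decisive p j (block j) x" using that by (auto simp: good_def)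
    have "e 0 = 0" using e a_mono[of 0 j] a_pos by (auto simp: near_ones_def)
    then have "act (t j \<otimes>\<^bsub>Fp_omega p\<^esub> e) x 0 = (- 1) mod int p"
      unfolding act_near_ones[OF x(1,3) e] using x(2) by (simp add: translate_def)
    then show ?thesis using p by (simp add: zmod_minus1)
  qed
  then show ?thesis by (auto simp: good_def)
qed

text \<open>The digit at 0 vanishes with probability \<open>1 / p\<close>, and the indecisive blocks remove at most half of
  that: the bounds add up to \<open>1 / (2 * p)\<close>.\<close>

lemma good_positive:
  assumes rare: "\<And>j. measure (digit_measure p) {x \<in> digits p. \<not> decisive p j (block j) x} < (1 / 2) ^ (j + 2) / p"
  shows "good \<in> sets (digit_measure p)" "measure (digit_measure p) good > 0"
proof -
  let ?M = "digit_measure p"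
  interpret prob_space ?M by (rule prob_space_digit_measure[OF p0])
  define Z where "Z = cylinder p 1 (\<lambda>i. 0)"
  define B where "B j = {x \<in> digits p. \<not> decisive p j (block j) x}" for j
  have zD: "(\<lambda>i. 0) \<in> digits p" using p by (simp add: digits_def)
  have "1 / ennreal (real p) = ennreal (1 / p)" using p0 divide_ennreal[of 1 p] by simp
  then have Z: "Z \<in> events" "prob Z = 1 / p"
    using sets_cylinder[OF p0 zD] emeasure_cylinder[OF p0 zD, of 1]
    by (simp_all add: Z_def measure_def)
  have B: "B j \<in> events" for j unfolding B_def by (rule sets_decisive[OF p0]) simp
  have eq: "good = Z - (\<Union>j. B j)"
    by (auto simp: good_def Z_def B_def cylinder_def)
  show "good \<in> events" unfolding eq using Z B by auto
  have gs: "(\<lambda>j. (1 / 2) ^ (j + 2) / real p) sums (1 / (2 * p))"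
  proof -
    have "(\<lambda>j. (1 / (4 * p)) * (1 / 2 :: real) ^ j) sums ((1 / (4 * p)) * (1 / (1 - 1 / 2)))"
      by (intro sums_mult geometric_sums) simp
    then show ?thesis by (simp add: power_add field_simps)
  qed
  have le: "prob (B j) \<le> (1 / 2) ^ (j + 2) / p" for j using rare[of j] by (simp add: B_def)
  have sum: "summable (\<lambda>j. prob (B j))"
    by (rule summable_comparison_test'[OF sums_summable[OF gs]]) (use le in simp)
  have "prob (\<Union>j. B j) \<le> (\<Sum>j. prob (B j))"
    by (rule finite_measure_subadditive_countably[OF _ sum]) (use B in auto)
  also have "\<dots> \<le> (\<Sum>j. (1 / 2) ^ (j + 2) / real p)"
    by (rule suminf_le[OF le sum sums_summable[OF gs]])
  also have "\<dots> = 1 / (2 * p)" using gs by (rule sums_unique[symmetric])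
  finally have small: "prob (\<Union>j. B j) \<le> 1 / (2 * p)" .
  have "prob Z \<le> prob (good \<union> (\<Union>j. B j))"
    using B \<open>good \<in> events\<close> by (intro finite_measure_mono sets.Un sets.countable_UN) (auto simp: eq)
  also have "\<dots> \<le> prob good + prob (\<Union>j. B j)"
    using B \<open>good \<in> events\<close> by (intro measure_Un_le) auto
  finally have "1 / p \<le> prob good + 1 / (2 * p)" using small Z(2) by simp
  moreover have "1 / real p - 1 / (2 * p) > 0" using p by (simp add: field_simps)
  ultimately show "prob good > 0" by linarith
qed

end


section \<open>Construction of the set\<close>

lemma countable_Fp_omega:
  assumes "p > 0"
  shows "countable (carrier (Fp_omega p))"
proof (rule countable_subset)
  let ?f = "\<lambda>(l :: int list) (i :: nat). if i < length l then l ! i else 0"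
  show "carrier (Fp_omega p) \<subseteq> range ?f"
  proof
    fix x assume "x \<in> carrier (Fp_omega p)"
    then have "finite {i. x i \<noteq> 0}" by (simp add: carrier_Fp_omega[OF assms])
    then obtain n where n: "\<forall>i\<in>{i. x i \<noteq> 0}. i < n" using finite_nat_set_iff_bounded by auto
    have "x = ?f (map x [0..<n])" using n by (auto simp: fun_eq_iff)
    then show "x \<in> range ?f" by blast
  qed
qed simp

lemma enumerate_infinitely_often:
  assumes "countable A" "A \<noteq> {}"
  obtains t :: "nat \<Rightarrow> 'a" where "range t \<subseteq> A" "\<And>x m. x \<in> A \<Longrightarrow> \<exists>j\<ge>m. t j = x"
proof
  define t where "t j = from_nat_into A (fst (prod_decode j))" for j
  show "range t \<subseteq> A" using from_nat_into[OF assms(2)] by (auto simp: t_def)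
  fix x m assume "x \<in> A"
  then obtain k where k: "from_nat_into A k = x"
    using from_nat_into_surj[OF assms(1)] by blast
  have "m \<le> prod_encode (k, m)" by (rule le_prod_encode_2)
  moreover have "t (prod_encode (k, m)) = x" using k by (simp add: t_def)
  ultimately show "\<exists>j\<ge>m. t j = x" by blast
qed

text \<open>The blocks are chosen one after the other: the length of block \<open>j\<close> may depend on where it starts,
  and it also has to bring the next block beyond the support of \<open>t (Suc j)\<close>.\<close>

lemma exists_block_schedule:
  assumes p: "p > 1" and t: "\<And>j. t j \<in> carrier (Fp_omega p)"
  shows "\<exists>a. skew_action p a t \<and> (\<forall>j. j < card {a j..<a (Suc j)}) \<and>
    (\<forall>j. measure (digit_measure p) {x \<in> digits p. \<not> decisive p j {a j..<a (Suc j)} x}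
        < (1 / 2) ^ (j + 2) / p)"
proof -
  have "\<exists>b. \<forall>i\<ge>b. t j i = 0" for j
  proof -
    have "finite {i. t j i \<noteq> 0}" using t[of j] p by (simp add: carrier_Fp_omega)
    then obtain n where n: "\<forall>i\<in>{i. t j i \<noteq> 0}. i < n" using finite_nat_set_iff_bounded by auto
    have "t j i = 0" if "n \<le> i" for i using n that by (cases "t j i = 0") auto
    then show ?thesis by blast
  qed
  then obtain b where b: "\<And>j i. b j \<le> i \<Longrightarrow> t j i = 0" by metis
  have ex: "\<exists>n>j + b (Suc j). measure (digit_measure p) {x \<in> digits p. \<not> decisive p j {m..<m+n} x}
      < (1 / 2) ^ (j + 2) / p" for j m
    by (rule rare_indecisive) (use p in auto)
  define N where "N j m = (SOME n. n > j + b (Suc j) \<and>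
      measure (digit_measure p) {x \<in> digits p. \<not> decisive p j {m..<m+n} x} < (1 / 2) ^ (j + 2) / p)" for j m
  have N: "j + b (Suc j) < N j m"
    "measure (digit_measure p) {x \<in> digits p. \<not> decisive p j {m..<m + N j m} x}
      < (1 / 2) ^ (j + 2) / p" for j m
    using someI_ex[OF ex[of j m]] unfolding N_def by (rule conjunct1, rule conjunct2)
  define a where "a = rec_nat (Suc (b 0)) (\<lambda>j m. m + N j m)"
  have a: "a 0 = Suc (b 0)" "a (Suc j) = a j + N j (a j)" for j by (simp_all add: a_def)
  have bound: "b j \<le> a j" for j
    using N(1)[of "j - 1" "a (j - 1)"] by (cases j) (simp_all add: a)
  show ?thesis
  proof (intro exI[of _ a] conjI allI)
    show "skew_action p a t"
    proof
      show "a j < a (Suc j)" for j using N(1)[of j "a j"] by (simp add: a)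
      show "t j i = 0" if "a j \<le> i" for j i using b bound[of j] that by simp
    qed (use p in \<open>simp_all add: a\<close>)
    show "j < card {a j..<a (Suc j)}" for j using N(1)[of j "a j"] by (simp add: a)
    show "measure (digit_measure p) {x \<in> digits p. \<not> decisive p j {a j..<a (Suc j)} x}
        < (1 / 2) ^ (j + 2) / p" for j
      using N(2)[of j "a j"] by (simp add: a)
  qed
qed

lemma exists_near_ones_translates_not_recurrent:
  assumes p: "p > 1"
  obtains S where "S \<subseteq> carrier (Fp_omega p)" "\<not> measurable_recurrence (Fp_omega p) S"
    "\<And>t m. t \<in> carrier (Fp_omega p) \<Longrightarrow> \<exists>I k. finite I \<and> m \<le> k \<and> k < card I \<and>
      (\<forall>e\<in>near_ones p I k. t \<otimes>\<^bsub>Fp_omega p\<^esub> e \<in> S)"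
proof -
  interpret group "Fp_omega p" by (rule group_Fp_omega)
  have p0: "p > 0" using p by simp
  have "carrier (Fp_omega p) \<noteq> {}" using one_closed by blast
  then obtain t :: "nat \<Rightarrow> nat \<Rightarrow> int" where t: "range t \<subseteq> carrier (Fp_omega p)"
      "\<And>x m. x \<in> carrier (Fp_omega p) \<Longrightarrow> \<exists>j\<ge>m. t j = x"
    using enumerate_infinitely_often[OF countable_Fp_omega[OF p0]] by blast
  have tC: "t j \<in> carrier (Fp_omega p)" for j using t(1) by blast
  from exists_block_schedule[OF p, of t, OF tC]
  obtain a where "skew_action p a t \<and> (\<forall>j. j < card {a j..<a (Suc j)}) \<and>
    (\<forall>j. measure (digit_measure p) {x \<in> digits p. \<not> decisive p j {a j..<a (Suc j)} x}
        < (1 / 2) ^ (j + 2) / p)" by (rule exE)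
  then have a: "skew_action p a t" "j < card {a j..<a (Suc j)}"
    "measure (digit_measure p) {x \<in> digits p. \<not> decisive p j {a j..<a (Suc j)} x}
        < (1 / 2) ^ (j + 2) / p" for j
    by (rule conjunct1, rule conjunct2[THEN conjunct1, THEN spec], rule conjunct2[THEN conjunct2, THEN spec])
  interpret skew_action p a t by (rule a(1))
  define S where "S = (\<Union>j. (\<lambda>e. t j \<otimes>\<^bsub>Fp_omega p\<^esub> e) ` near_ones p (block j) j)"
  have S: "S \<subseteq> carrier (Fp_omega p)"
  proof -
    have "t j \<otimes>\<^bsub>Fp_omega p\<^esub> e \<in> carrier (Fp_omega p)" if "e \<in> near_ones p (block j) j" for j e
      using near_ones_carrier[OF p0, of "block j" j] that by (intro m_closed tC) auto
    then show ?thesis unfolding S_def by blast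
  qed
  show thesis
  proof (rule that[OF S])
    obtain f :: "(nat \<Rightarrow> int) \<Rightarrow> real" where f: "inj f" using int_sequences_inj_real by blast
    show "\<not> measurable_recurrence (Fp_omega p) S"
    proof (rule not_measurable_recurrenceI[OF f prob_space_digit_measure[OF p0]
          measure_preserving_act good_positive[OF a(3)] S])
      fix g assume "g \<in> S"
      then obtain j e where "e \<in> near_ones p (block j) j" "g = t j \<otimes>\<^bsub>Fp_omega p\<^esub> e"
        by (auto simp: S_def)
      then have "good \<inter> act g ` good = {}" using good_disjoint by blast
      then show "measure (digit_measure p) (good \<inter> act g ` good) = 0" by simp
    qed
    fix x m assume "x \<in> carrier (Fp_omega p)"
    then obtain j where j: "m \<le> j" "t j = x" using t(2) by blast
    have "x \<otimes>\<^bsub>Fp_omega p\<^esub> e \<in> S" if "e \<in> near_ones p (block j) j" for e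
      using that j(2) unfolding S_def by blast
    then show "\<exists>I k. finite I \<and> m \<le> k \<and> k < card I \<and>
        (\<forall>e\<in>near_ones p I k. x \<otimes>\<^bsub>Fp_omega p\<^esub> e \<in> S)"
      using j(1) a(2)[of j] by (intro exI[of _ "block j"] exI[of _ j]) simp
  qed
qed

theorem corollary1p10:
  shows "(\<exists>S \<subseteq> carrier (Fp_omega 2).
            (\<forall>t\<in>carrier (Fp_omega 2). topological_recurrence (Fp_omega 2) (t <#\<^bsub>Fp_omega 2\<^esub> S)) \<and>
            \<not> measurable_recurrence (Fp_omega 2) S) \<and>
         (\<forall>p::nat. Factorial_Ring.prime p \<longrightarrow>
            (\<exists>S \<subseteq> carrier (Fp_omega p).
               bohr_dense (Fp_omega p) S \<and> \<not> measurable_recurrence (Fp_omega p) S))"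
proof (intro conjI allI impI)
  let ?G = "Fp_omega 2"
  obtain S where S: "S \<subseteq> carrier ?G" "\<not> measurable_recurrence ?G S"
    "\<And>t m. t \<in> carrier ?G \<Longrightarrow> \<exists>I k. finite I \<and> m \<le> k \<and> k < card I \<and>
      (\<forall>e\<in>near_ones 2 I k. t \<otimes>\<^bsub>?G\<^esub> e \<in> S)"
    using exists_near_ones_translates_not_recurrent[of 2] by auto
  have "topological_recurrence ?G (t <#\<^bsub>?G\<^esub> S)" if t: "t \<in> carrier ?G" for t
  proof (rule topological_recurrence_near_ones)
    fix r
    obtain I k where I: "finite I" "r \<le> k" "k < card I" "\<forall>e\<in>near_ones 2 I k. t \<otimes>\<^bsub>?G\<^esub> e \<in> S"
      using S(3)[OF t] by blast
    have "e \<in> t <#\<^bsub>?G\<^esub> S" if e: "e \<in> near_ones 2 I k" for e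
    proof -
      \<comment> \<open>for \<open>p = 2\<close> the element \<open>t\<close> is its own inverse, so \<open>t + S\<close> contains \<open>t + (t + E\<^sub>j)\<close>\<close>
      have "(t i + (t i + e i)) mod 2 = e i" for i
      proof -
        have "(t i + (t i + e i)) mod 2 = e i mod 2" by presburger
        then show ?thesis using e by (simp add: near_ones_def)
      qed
      then have "e = t \<otimes>\<^bsub>?G\<^esub> (t \<otimes>\<^bsub>?G\<^esub> e)" by (simp add: mod_simps)
      then show ?thesis using I(4) e unfolding l_coset_def by blast
    qed
    then show "\<exists>I k. finite I \<and> r \<le> k \<and> k < card I \<and> near_ones 2 I k \<subseteq> t <#\<^bsub>?G\<^esub> S"
      using I(1-3) by blast
  qed
  then show "\<exists>S\<subseteq>carrier ?G. (\<forall>t\<in>carrier ?G. topological_recurrence ?G (t <#\<^bsub>?G\<^esub> S)) \<and>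
      \<not> measurable_recurrence ?G S"
    using S(1,2) by blast
next
  fix p :: nat assume p: "Factorial_Ring.prime p"
  obtain S where S: "S \<subseteq> carrier (Fp_omega p)" "\<not> measurable_recurrence (Fp_omega p) S"
    "\<And>t m. t \<in> carrier (Fp_omega p) \<Longrightarrow> \<exists>I k. finite I \<and> m \<le> k \<and> k < card I \<and>
      (\<forall>e\<in>near_ones p I k. t \<otimes>\<^bsub>Fp_omega p\<^esub> e \<in> S)"
    using exists_near_ones_translates_not_recurrent[OF prime_gt_1_nat[OF p]] by blast
  have "bohr_dense (Fp_omega p) S"
    by (rule bohr_dense_near_ones[OF p S(1)]) (use S(3) in blast)
  then show "\<exists>S\<subseteq>carrier (Fp_omega p). bohr_dense (Fp_omega p) S \<and> \<not> measurable_recurrence (Fp_omega p) S"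
    using S by blast
qed

end
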